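(* Let $\mathcal X$ and $\mathcal Y_i$, $i=0,\dots,N-1$, be reflexive Banach spaces with each $\mathcal Y_i$ uniformly smooth, and let $\Theta$ and $F_i$, $i=0,\dots,N-1$, satisfy assumption (A1) of the context, and $S_\varepsilon$ assumption (A2). Let $\{\varepsilon_n\}_{n\ge 0}$ be a sequence of positive numbers with $16\sum_{n=0}^\infty \varepsilon_n\le c_0\rho^p$. Let $\beta>1$ be a constant with $\beta\gamma<1$, let $\beta_1>0$, let $\beta_0>0$ be such that $$\frac1\beta-\gamma-\frac{2}{p^*}\Big(\frac{\beta_0}{2c_0}\Big)^{p^*-1}>0,$$ and let $\sigma>0$ be such that $\kappa\beta_1\sigma\le 1$, where $\kappa=1$ if $p\ge s$ and $\kappa=(\beta^{\frac{p}{s-p}}-1)^{\frac{p-s}{p}}$ if $p<s$. Let $\{(\xi_n,x_n)\}_{n\ge0}$ be generated by the Landweber-Kaczmarz method with exact data described in the context. Then there exists a solution $x_*\in B_{2\rho}(x_0)\cap \mathscr D(\Theta)$ of the system $F_i(x)=y_i$, $i=0,\dots,N-1$, such that $$\lim_{n\to\infty}\|x_n-x_*\|=0\quad\text{and}\quad \lim_{n\to\infty}D^{\varepsilon_n}_{\xi_n}\Theta(x_*,x_n)=0.$$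
   Context: All Banach spaces are real; $\mathcal X^*$ is the dual, $\langle\xi,x\rangle=\xi(x)$ for $\xi\in\mathcal X^*$, $x\in\mathcal X$. $B_r(x_0)=\{x\in\mathcal X:\|x-x_0\|\le r\}$. For $\Theta:\mathcal X\to(-\infty,\infty]$, $\mathscr D(\Theta)=\{x:\Theta(x)<\infty\}$. For $\varepsilon\ge0$, the $\varepsilon$-subdifferential is $\partial_\varepsilon\Theta(x)=\{\xi\in\mathcal X^*:\Theta(\bar x)\ge\Theta(x)+\langle\xi,\bar x-x\rangle-\varepsilon\ \forall\bar x\in\mathcal X\}$, and $\partial\Theta=\partial_0\Theta$. For $\xi\in\partial_\varepsilon\Theta(x)$ the $\varepsilon$-Bregman distance is $D^\varepsilon_\xi\Theta(\bar x,x)=\Theta(\bar x)-\Theta(x)-\langle\xi,\bar x-x\rangle+\varepsilon$; $D_\xi\Theta=D^0_\xi\Theta$. $\Theta$ is $p$-convex ($p\ge2$) with constant $c_0>0$ if $\Theta(t\bar x+(1-t)x)+c_0t(1-t)\|\bar x-x\|^p\le t\Theta(\bar x)+(1-t)\Theta(x)$ for all $0\le t\le1$, $\bar x,x\in\mathcal X$. $p^*$ is the conjugate exponent, $1/p+1/p^*=1$. For $1<s<\infty$ fixed, $J_s^{\mathcal Y_i}(y)=\{\zeta\in\mathcal Y_i^*:\|\zeta\|=\|y\|^{s-1},\ \langle\zeta,y\rangle=\|y\|^s\}$ is the duality mapping, single valued since $\mathcal Y_i$ is uniformly smooth. Problem: $F_i(x)=y_i$, $i=0,\dots,N-1$, with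 $F_i:\mathscr D(F_i)\subset\mathcal X\to\mathcal Y_i$; put $\mathscr D=\bigcap_{i=0}^{N-1}\mathscr D(F_i)$. Assumption (A1): (a) $\Theta:\mathcal X\to(-\infty,\infty]$ is proper, lower semi-continuous and $p$-convex with constant $c_0$. (b) There exist $\rho>0$, $x_0\in\mathcal X$, $\xi_0\in\partial\Theta(x_0)$ such that $B_{2\rho}(x_0)\subset\mathscr D$ and the system has a solution $x^\dagger\in\mathscr D(\Theta)$ with $D_{\xi_0}\Theta(x^\dagger,x_0)\le\frac14c_0\rho^p$. (c) For each $i$ there is a family of bounded linear operators $L_i(x):\mathcal X\to\mathcal Y_i$, $x\in B_{2\rho}(x_0)$, such that $x\mapsto L_i(x)$ is continuous on $B_{2\rho}(x_0)$ (operator norm), and there is $0\le\gamma<1$ with $\|F_i(\bar x)-F_i(x)-L_i(x)(\bar x-x)\|\le\gamma\|F_i(\bar x)-F_i(x)\|$ for all $\bar x,x\in B_{2\rho}(x_0)$ and all $i$. Assumption (A2): for each $\varepsilon>0$, $S_\varepsilon:\mathcal X^*\to\mathcal X$ is a continuous mapping such that for every $\xi\in\mathcal X^*$, $x=S_\varepsilon(\xi)$ satisfies $\Theta(x)-\langle\xi,x\rangle\le\min_{z\in\mathcal X}\{\Theta(z)-\langle\xi,z\rangle\}+\varepsilon$. Landweber-Kaczmarz method with exact data: start from the $x_0,\xi_0$ of (A1)(b). With $i_n=n\ (\mathrm{mod}\ N)$, for $n\ge0$ set $r_n=F_{i_n}(x_n)-y_{i_n}$, $$\tilde\mu_n=\min\Big\{\frac{\beta_0\|r_n\|^{p(s-1)}}{\|L_{i_n}(x_n)^*J_s^{\mathcal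 Y_{i_n}}(r_n)\|^p},\beta_1\Big\},\qquad \mu_n=\tilde\mu_n(\|r_n\|^p+\sigma\varepsilon_n)^{1-\frac sp},$$ with $\tilde\mu_n=\beta_1$ when the denominator is zero, and $$\xi_{n+1}=\xi_n-\mu_nL_{i_n}(x_n)^*J_s^{\mathcal Y_{i_n}}(r_n),\qquad x_{n+1}=S_{\varepsilon_{n+1}}(\xi_{n+1}).$$ Consequently $\xi_n\in\partial_{\varepsilon_n}\Theta(x_n)$ for all $n$. *)

theory Defs
  imports "HOL-Analysis.Analysis"
begin

text \<open>
  The spaces Y_i form a family indexed by a variable number N of indices, so they cannot be
  N separate types. They are taken to be closed subspaces of one ambient Banach space, with the
  inherited norm. Any finite family of Banach spaces embeds isometrically in this way in its direct
  sum, so this is no restriction; nothing is assumed about the ambient space itself.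
  The dual of a subspace S consists of the bounded linear functionals on S, set to 0
  off S so that each functional is represented by exactly one function.
\<close>

definition dual_on :: "'a::real_normed_vector set \<Rightarrow> ('a \<Rightarrow> real) set" where
  "dual_on S = {\<zeta>.
     (\<forall>y\<in>S. \<forall>z\<in>S. \<zeta> (y + z) = \<zeta> y + \<zeta> z) \<and>
     (\<forall>c. \<forall>y\<in>S. \<zeta> (c *\<^sub>R y) = c * \<zeta> y) \<and>
     (\<exists>K. \<forall>y\<in>S. \<bar>\<zeta> y\<bar> \<le> K * norm y) \<and>
     (\<forall>y. y \<notin> S \<longrightarrow> \<zeta> y = 0)}"

definition dual_norm_on :: "'a::real_normed_vector set \<Rightarrow> ('a \<Rightarrow> real) \<Rightarrow> real" where
  "dual_norm_on S \<zeta> = Sup ((\<lambda>y. \<bar>\<zeta> y\<bar>) ` {y \<in> S. norm y \<le> 1})"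

definition bidual_on :: "'a::real_normed_vector set \<Rightarrow> (('a \<Rightarrow> real) \<Rightarrow> real) set" where
  "bidual_on S = {\<Phi>.
     (\<forall>\<zeta>\<in>dual_on S. \<forall>\<eta>\<in>dual_on S. \<Phi> (\<lambda>y. \<zeta> y + \<eta> y) = \<Phi> \<zeta> + \<Phi> \<eta>) \<and>
     (\<forall>c. \<forall>\<zeta>\<in>dual_on S. \<Phi> (\<lambda>y. c * \<zeta> y) = c * \<Phi> \<zeta>) \<and>
     (\<exists>K. \<forall>\<zeta>\<in>dual_on S. \<bar>\<Phi> \<zeta>\<bar> \<le> K * dual_norm_on S \<zeta>)}"

definition reflexive_on :: "'a::real_normed_vector set \<Rightarrow> bool" where
  "reflexive_on S \<longleftrightarrow> (\<forall>\<Phi>\<in>bidual_on S. \<exists>y\<in>S. \<forall>\<zeta>\<in>dual_on S. \<Phi> \<zeta> = \<zeta> y)"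

text \<open>The inserted 0 matters only for the zero space, whose unit sphere is empty.\<close>

definition modulus_of_smoothness_on :: "'a::real_normed_vector set \<Rightarrow> real \<Rightarrow> real" where
  "modulus_of_smoothness_on S \<tau> =
     Sup (insert 0 {(norm (y + z) + norm (y - z)) / 2 - 1 | y z.
                      y \<in> S \<and> z \<in> S \<and> norm y = 1 \<and> norm z \<le> \<tau>})"

definition uniformly_smooth_on :: "'a::real_normed_vector set \<Rightarrow> bool" where
  "uniformly_smooth_on S \<longleftrightarrow> ((\<lambda>\<tau>. modulus_of_smoothness_on S \<tau> / \<tau>) \<longlongrightarrow> 0) (at_right 0)"

definition duality_map_on :: "'a::real_normed_vector set \<Rightarrow> real \<Rightarrow> 'a \<Rightarrow> ('a \<Rightarrow> real) set" where
  "duality_map_on S s y =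
     {\<zeta> \<in> dual_on S. dual_norm_on S \<zeta> = norm y powr (s - 1) \<and> \<zeta> y = norm y powr s}"

text \<open>
  The Banach space adjoint of an operator A with range in S, applied to an element of the dual
  of S.
\<close>

definition adjoint_apply ::
    "('a::real_normed_vector \<Rightarrow>\<^sub>L 'b::real_normed_vector) \<Rightarrow> ('b \<Rightarrow> real) \<Rightarrow> ('a \<Rightarrow>\<^sub>L real)" where
  "adjoint_apply A \<zeta> = Blinfun (\<lambda>h. \<zeta> (blinfun_apply A h))"

lemma blinfun_apply_adjoint_apply:
  assumes "\<zeta> \<in> dual_on S" and "range (blinfun_apply A) \<subseteq> S"
  shows "blinfun_apply (adjoint_apply A \<zeta>) h = \<zeta> (blinfun_apply A h)"
proof -
  have A: "blinfun_apply A h \<in> S" for h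
    using assms(2) by blast
  obtain K where K: "\<bar>\<zeta> y\<bar> \<le> K * norm y" if "y \<in> S" for y
    using assms(1) unfolding dual_on_def by blast
  have "bounded_linear (\<lambda>h. \<zeta> (blinfun_apply A h))"
  proof (rule bounded_linear_intro)
    fix x
    have "\<bar>\<zeta> (blinfun_apply A x)\<bar> \<le> K * norm (blinfun_apply A x)"
      using K A by blast
    also have "\<dots> \<le> \<bar>K\<bar> * (norm A * norm x)"
      by (intro mult_mono norm_blinfun) auto
    finally show "norm (\<zeta> (blinfun_apply A x)) \<le> norm x * (\<bar>K\<bar> * norm A)"
      by (simp add: ac_simps)
  qed (use assms(1) A in \<open>auto simp: dual_on_def blinfun.add_right blinfun.scaleR_right\<close>)
  then show ?thesis
    by (simp add: adjoint_apply_def bounded_linear_Blinfun_apply)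
qed

definition eff_dom :: "('a \<Rightarrow> ereal) \<Rightarrow> 'a set" where
  "eff_dom \<Theta> = {x. \<Theta> x < \<infinity>}"

definition proper_fun :: "('a \<Rightarrow> ereal) \<Rightarrow> bool" where
  "proper_fun \<Theta> \<longleftrightarrow> (\<forall>x. \<Theta> x \<noteq> -\<infinity>) \<and> eff_dom \<Theta> \<noteq> {}"

definition lower_semicont :: "('a::topological_space \<Rightarrow> ereal) \<Rightarrow> bool" where
  "lower_semicont \<Theta> \<longleftrightarrow> (\<forall>x. \<Theta> x \<le> Liminf (at x) \<Theta>)"

definition p_convex :: "real \<Rightarrow> real \<Rightarrow> ('a::real_normed_vector \<Rightarrow> ereal) \<Rightarrow> bool" where
  "p_convex p c\<^sub>0 \<Theta> \<longleftrightarrow>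
     (\<forall>t x' x. 0 \<le> t \<and> t \<le> 1 \<longrightarrow>
        \<Theta> (t *\<^sub>R x' + (1 - t) *\<^sub>R x) + ereal (c\<^sub>0 * t * (1 - t) * norm (x' - x) powr p)
          \<le> ereal t * \<Theta> x' + ereal (1 - t) * \<Theta> x)"

definition eps_subdiff ::
    "real \<Rightarrow> ('a::real_normed_vector \<Rightarrow> ereal) \<Rightarrow> 'a \<Rightarrow> ('a \<Rightarrow>\<^sub>L real) set" where
  "eps_subdiff \<epsilon> \<Theta> x =
     {\<xi>. \<forall>x'. \<Theta> x' \<ge> \<Theta> x + ereal (blinfun_apply \<xi> (x' - x)) - ereal \<epsilon>}"

definition bregman_dist ::
    "real \<Rightarrow> ('a::real_normed_vector \<Rightarrow>\<^sub>L real) \<Rightarrow> ('a \<Rightarrow> ereal) \<Rightarrow> 'a \<Rightarrow> 'a \<Rightarrow> ereal" where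
  "bregman_dist \<epsilon> \<xi> \<Theta> x' x = \<Theta> x' - \<Theta> x - ereal (blinfun_apply \<xi> (x' - x)) + ereal \<epsilon>"

definition is_solution ::
    "nat \<Rightarrow> (nat \<Rightarrow> 'a set) \<Rightarrow> (nat \<Rightarrow> 'a \<Rightarrow> 'b) \<Rightarrow> (nat \<Rightarrow> 'b) \<Rightarrow> 'a \<Rightarrow> bool" where
  "is_solution N D F y x \<longleftrightarrow> (\<forall>i<N. x \<in> D i \<and> F i x = y i)"

text \<open>
  Here r stands for the norm of the residual, g for the norm of the adjoint applied to the
  duality mapping of the residual, and e for the current tolerance.
\<close>

definition step_tilde :: "real \<Rightarrow> real \<Rightarrow> real \<Rightarrow> real \<Rightarrow> real \<Rightarrow> real \<Rightarrow> real" where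
  "step_tilde p s \<beta>\<^sub>0 \<beta>\<^sub>1 r g =
     (if g = 0 then \<beta>\<^sub>1 else min (\<beta>\<^sub>0 * r powr (p * (s - 1)) / g powr p) \<beta>\<^sub>1)"

definition step_size ::
    "real \<Rightarrow> real \<Rightarrow> real \<Rightarrow> real \<Rightarrow> real \<Rightarrow> real \<Rightarrow> real \<Rightarrow> real \<Rightarrow> real" where
  "step_size p s \<beta>\<^sub>0 \<beta>\<^sub>1 \<sigma> e r g =
     step_tilde p s \<beta>\<^sub>0 \<beta>\<^sub>1 r g * (r powr p + \<sigma> * e) powr (1 - s / p)"

text \<open>
  The sequence j selects the elements of the duality mapping; for a uniformly smooth space the
  duality mapping is single valued and j is determined by the iterates.
\<close>

definition landweber_kaczmarz ::
    "nat \<Rightarrow> (nat \<Rightarrow> 'b::real_normed_vector set) \<Rightarrow> (nat \<Rightarrow> 'a::real_normed_vector \<Rightarrow> 'b) \<Rightarrow>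
     (nat \<Rightarrow> 'b) \<Rightarrow> (nat \<Rightarrow> 'a \<Rightarrow> ('a \<Rightarrow>\<^sub>L 'b)) \<Rightarrow> (real \<Rightarrow> ('a \<Rightarrow>\<^sub>L real) \<Rightarrow> 'a) \<Rightarrow> (nat \<Rightarrow> real) \<Rightarrow>
     real \<Rightarrow> real \<Rightarrow> real \<Rightarrow> real \<Rightarrow> real \<Rightarrow> 'a \<Rightarrow> ('a \<Rightarrow>\<^sub>L real) \<Rightarrow>
     (nat \<Rightarrow> ('a \<Rightarrow>\<^sub>L real)) \<Rightarrow> (nat \<Rightarrow> 'a) \<Rightarrow> bool" where
  "landweber_kaczmarz N Y F y L S \<epsilon> p s \<beta>\<^sub>0 \<beta>\<^sub>1 \<sigma> x\<^sub>0 \<xi>\<^sub>0 \<xi> x \<longleftrightarrow>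
     \<xi> 0 = \<xi>\<^sub>0 \<and> x 0 = x\<^sub>0 \<and>
     (\<exists>j. \<forall>n.
        (let i = n mod N;
             r = F i (x n) - y i;
             g = adjoint_apply (L i (x n)) (j n)
         in j n \<in> duality_map_on (Y i) s r \<and>
            \<xi> (Suc n) = \<xi> n - step_size p s \<beta>\<^sub>0 \<beta>\<^sub>1 \<sigma> (\<epsilon> n) (norm r) (norm g) *\<^sub>R g \<and>
            x (Suc n) = S (\<epsilon> (Suc n)) (\<xi> (Suc n))))"

end

theory Submission
  imports Defs
begin

text \<open>
  For a fixed solution \<open>z\<close> write \<open>b\<^sub>n = \<Theta> z - \<Theta> x\<^sub>n - \<xi>\<^sub>n (z - x\<^sub>n)\<close> and \<open>h = \<xi>\<^sub>n\<^sub>+\<^sub>1 - \<xi>\<^sub>n\<close>.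
  The method is a descent method for \<open>b\<^sub>n\<close>. Since \<open>\<xi>\<^sub>n\<close> is an \<open>\<epsilon>\<^sub>n\<close>-subgradient at \<open>x\<^sub>n\<close>, \<open>p\<close>-convexity
  bounds \<open>c\<^sub>0/2 * norm (z - x\<^sub>n)^p\<close> by \<open>b\<^sub>n + 2\<epsilon>\<^sub>n\<close> (\<open>bregman_growth\<close>). The change of \<open>b\<^sub>n\<close> is
  \<open>h (x\<^sub>n - z)\<close>, plus \<open>h (x\<^sub>n\<^sub>+\<^sub>1 - x\<^sub>n)\<close>, minus the Bregman distance of \<open>x\<^sub>n\<^sub>+\<^sub>1\<close> from \<open>x\<^sub>n\<close>; growth and
  Young's inequality bound the last two terms by a multiple of the \<open>p*\<close>-th power of the norm of \<open>h\<close>, up to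
  \<open>2\<epsilon>\<^sub>n\<close> (\<open>bregman_step\<close>). The tangential cone condition makes the first term at most
  \<open>-(1 - \<gamma>) \<mu>\<^sub>n r\<^sub>n^s\<close>, where \<open>r\<^sub>n\<close> is the norm of the residual, and the step rule is designed so that
  the power of \<open>h\<close> is at most a multiple of \<open>\<mu>\<^sub>n r\<^sub>n^s + \<epsilon>\<^sub>n\<close> (\<open>step_energy\<close>). Thus \<open>b\<^sub>n\<close> decreases
  up to the summable errors \<open>3\<epsilon>\<^sub>n\<close>. This keeps the iterates in the ball, makes \<open>b\<^sub>n\<close> converge
  for every solution in the ball, and makes \<open>\<mu>\<^sub>n r\<^sub>n^s\<close>, hence \<open>r\<^sub>n^p\<close>, summable.

  It remains to find a strongly convergent subsequence. By the three-point identity for Bregman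
  distances, iterates with indices \<open>l < k\<close> are close once \<open>(\<xi>\<^sub>k - \<xi>\<^sub>l) (x\<^sub>k - xdag)\<close> is small
  for one solution \<open>xdag\<close>. Each increment
  \<open>\<xi>\<^sub>m\<^sub>+\<^sub>1 - \<xi>\<^sub>m\<close> contributes to this pairing at most a multiple of \<open>T\<^sub>m^(p-1)\<close> times \<open>T\<^sub>m\<close> plus a residual at
  \<open>x\<^sub>k\<close>, where \<open>T\<^sub>m^p\<close> is \<open>r\<^sub>m^p\<close> plus tolerances and therefore summable. All residuals
  at \<open>x\<^sub>k\<close> are controlled by the sum \<open>Q\<^sub>k\<close> of \<open>T\<close> over one cycle of \<open>N\<close> steps. Restricting \<open>k\<close> to indices
  at which \<open>Q\<close> is no larger than at any earlier index replaces \<open>Q\<^sub>k\<close> by \<open>Q\<^sub>m\<close>, so that the pairing is bounded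
  by a tail of the convergent series \<open>\<Sum> Q\<^sub>m^p\<close> (\<open>dual_cauchy_along_record_minima\<close>). The limit of
  the subsequence is a solution, lower semicontinuity makes its Bregman distances tend to 0 along the
  subsequence, and since these distances converge along the full sequence, so does \<open>x\<^sub>n\<close>
  (\<open>convergence_from_subsequence\<close>).
\<close>

section \<open>Inexact subgradients of p-convex functions\<close>

definition bregman_real ::
    "('a \<Rightarrow> real) \<Rightarrow> ('a::real_normed_vector \<Rightarrow>\<^sub>L real) \<Rightarrow> 'a \<Rightarrow> 'a \<Rightarrow> real" where
  "bregman_real \<theta> \<xi> z x = \<theta> z - \<theta> x - \<xi> (z - x)"

text \<open>
  The change of base point costs only the pairing of the two subgradients with \<open>w - z\<close>.
  This turns convergence of the distances to one fixed \<open>z\<close> into closeness of the base points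
  to each other.
\<close>

lemma bregman_real_three_points:
  "bregman_real \<theta> \<xi> w x = bregman_real \<theta> \<xi> z x - bregman_real \<theta> \<eta> z w + blinfun_apply (\<eta> - \<xi>) (w - z)"
  by (simp add: bregman_real_def blinfun.diff_left blinfun.diff_right)

text \<open>
  An extended-real functional enters through its effective domain \<open>A\<close> and its finite values \<open>\<theta>\<close> there,
  so that all estimates are estimates of real numbers. Lower semicontinuity is stated by sequences and
  sublevel sets, which also covers limits that are not known to lie in \<open>A\<close>.
\<close>

locale p_convex_function =
  fixes A :: "'a::banach set" and \<theta> :: "'a \<Rightarrow> real" and p c :: real
  assumes p_ge_2: "p \<ge> 2" and c_pos: "c > 0"
    and convex_combination_in:
      "\<And>x z t. x \<in> A \<Longrightarrow> z \<in> A \<Longrightarrow> 0 \<le> t \<Longrightarrow> t \<le> 1 \<Longrightarrow> t *\<^sub>R z + (1 - t) *\<^sub>R x \<in> A"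
    and p_convexity:
      "\<And>x z t. x \<in> A \<Longrightarrow> z \<in> A \<Longrightarrow> 0 \<le> t \<Longrightarrow> t \<le> 1 \<Longrightarrow>
         \<theta> (t *\<^sub>R z + (1 - t) *\<^sub>R x) + c * t * (1 - t) * norm (z - x) powr p \<le> t * \<theta> z + (1 - t) * \<theta> x"
    and lower_semicontinuity:
      "\<And>u v C. u \<longlonglongrightarrow> v \<Longrightarrow> (\<forall>\<^sub>F k in sequentially. u k \<in> A \<and> \<theta> (u k) \<le> C) \<Longrightarrow> v \<in> A \<and> \<theta> v \<le> C"
begin

definition subgradient :: "real \<Rightarrow> ('a \<Rightarrow>\<^sub>L real) \<Rightarrow> 'a \<Rightarrow> bool" where
  "subgradient e \<xi> x \<longleftrightarrow> x \<in> A \<and> (\<forall>z\<in>A. bregman_real \<theta> \<xi> z x \<ge> - e)"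

text \<open>
  Test the \<open>e\<close>-subgradient inequality at the midpoint of \<open>x\<close> and \<open>z\<close>, where \<open>p\<close>-convexity gains
  \<open>c/4 * norm (z - x) powr p\<close>. Letting the point tend to \<open>x\<close> instead would restore the
  constant \<open>c\<close>, but would multiply the error \<open>e\<close> without bound.
\<close>

lemma bregman_growth:
  assumes "subgradient e \<xi> x" and z: "z \<in> A"
  shows "c / 2 * norm (z - x) powr p \<le> bregman_real \<theta> \<xi> z x + 2 * e"
proof -
  have x: "x \<in> A" and sub: "\<And>z. z \<in> A \<Longrightarrow> bregman_real \<theta> \<xi> z x \<ge> - e"
    using assms unfolding subgradient_def by auto
  define m where "m = (1 / 2) *\<^sub>R z + (1 - 1 / 2) *\<^sub>R x"
  have m: "m \<in> A" unfolding m_def by (rule convex_combination_in) (use x z in auto)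
  have mx: "m - x = (1 / 2) *\<^sub>R (z - x)"
  proof -
    have "m - x = (1 / 2) *\<^sub>R z + ((1 - 1 / 2) *\<^sub>R x - 1 *\<^sub>R x)"
      by (simp only: m_def scaleR_one add_diff_eq)
    also have "(1 - 1 / 2) *\<^sub>R x - 1 *\<^sub>R x = (- 1 / 2) *\<^sub>R x"
      by (simp only: scaleR_left_diff_distrib[symmetric]) simp
    finally show ?thesis by (simp add: scaleR_diff_right)
  qed
  have "\<theta> m + c * (1 / 2) * (1 - 1 / 2) * norm (z - x) powr p \<le> 1 / 2 * \<theta> z + (1 - 1 / 2) * \<theta> x"
    unfolding m_def by (rule p_convexity) (use x z in auto)
  moreover have "\<theta> m - \<theta> x - \<xi> (z - x) / 2 \<ge> - e"
    using sub[OF m] unfolding bregman_real_def mx by (simp add: blinfun.scaleR_right)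
  ultimately show ?thesis
    unfolding bregman_real_def by (simp add: algebra_simps)
qed

text \<open>
  Strong monotonicity of the inexact subdifferential: apply the growth estimate in both directions and add.
  It converts small dual increments into small primal ones.
\<close>

lemma distance_between_subgradients:
  assumes x: "subgradient e \<xi> x" and x': "subgradient e' \<xi>' x'"
  shows "c * norm (x' - x) powr p \<le> norm (\<xi>' - \<xi>) * norm (x' - x) + 2 * e + 2 * e'"
proof -
  have "c / 2 * norm (x' - x) powr p \<le> bregman_real \<theta> \<xi> x' x + 2 * e"
    by (rule bregman_growth[OF x]) (use x' in \<open>simp add: subgradient_def\<close>)
  moreover have "c / 2 * norm (x - x') powr p \<le> bregman_real \<theta> \<xi>' x x' + 2 * e'"
    by (rule bregman_growth[OF x']) (use x in \<open>simp add: subgradient_def\<close>)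
  moreover have "bregman_real \<theta> \<xi> x' x + bregman_real \<theta> \<xi>' x x' = blinfun_apply (\<xi>' - \<xi>) (x' - x)"
    by (simp add: bregman_real_def blinfun.diff_left blinfun.diff_right)
  moreover have "blinfun_apply (\<xi>' - \<xi>) (x' - x) \<le> norm (\<xi>' - \<xi>) * norm (x' - x)"
    using norm_blinfun[of "\<xi>' - \<xi>" "x' - x"] by simp
  ultimately show ?thesis
    by (simp add: norm_minus_commute field_simps)
qed

text \<open>
  The pairing of \<open>\<xi>' - \<xi>\<close> with \<open>x' - x\<close> is absorbed by the growth of the Bregman distance
  of \<open>x'\<close> from \<open>x\<close>, whatever \<open>x'\<close> is; this replaces the smoothness of the conjugate functional.
  The factor 2 in front of the power is the price of the halved constant in \<open>bregman_growth\<close>.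
\<close>

lemma bregman_step:
  assumes x: "subgradient e \<xi> x" and x': "x' \<in> A"
    and q: "1 / p + 1 / q = 1"
  shows "bregman_real \<theta> \<xi>' z x' \<le> bregman_real \<theta> \<xi> z x + blinfun_apply (\<xi>' - \<xi>) (x - z)
           + 2 / q * norm (\<xi>' - \<xi>) powr q / (2 * c) powr (q - 1) + 2 * e"
proof -
  define h where "h = norm (\<xi>' - \<xi>)"
  define d where "d = norm (x' - x)"
  have hd: "h \<ge> 0" "d \<ge> 0" by (auto simp: h_def d_def)
  have q1: "1 / q = 1 - 1 / p" using q by simp
  have "1 / q \<ge> 1 / 2" "1 / q < 1" unfolding q1 using p_ge_2 by (auto simp: field_simps)
  then have q_pos: "q > 0" by (smt (verit) divide_le_0_iff)
  have q_le: "q \<le> 2" "q > 1"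
    using \<open>1 / q \<ge> 1 / 2\<close> \<open>1 / q < 1\<close> q_pos by (auto simp: field_simps)
  have pq: "1 / p * q = q - 1"
    using q q_pos p_ge_2 by (simp add: field_simps)
  \<comment> \<open>The weights are chosen so that Young's inequality returns exactly \<open>c / p * d powr p\<close>.\<close>
  have "h * d = (c powr (1 / p) * d) * (h / c powr (1 / p))"
    using c_pos by simp
  also have "\<dots> \<le> (c powr (1 / p) * d) powr p / p + (h / c powr (1 / p)) powr q / q"
    by (rule Youngs_inequality) (use p_ge_2 q q_le hd in auto)
  also have "(c powr (1 / p) * d) powr p = c * d powr p"
    using c_pos hd p_ge_2 by (simp add: powr_mult powr_powr)
  also have "(h / c powr (1 / p)) powr q = h powr q / c powr (q - 1)"
    using c_pos hd pq by (simp add: powr_divide powr_powr)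
  also have "c * d powr p / p \<le> c * d powr p / 2"
    using p_ge_2 c_pos by (intro divide_left_mono) auto
  \<comment> \<open>Since \<open>q \<le> 2\<close>, passing from \<open>c\<close> to \<open>2 * c\<close> costs at most a factor 2.\<close>
  also have "h powr q / c powr (q - 1) / q \<le> 2 / q * h powr q / (2 * c) powr (q - 1)"
  proof -
    have "(2 * c) powr (q - 1) = 2 powr (q - 1) * c powr (q - 1)"
      using c_pos by (simp add: powr_mult)
    also have "\<dots> \<le> 2 * c powr (q - 1)"
      using powr_mono[of "q - 1" 1 "2::real"] q_le by (intro mult_right_mono) auto
    finally have le: "(2 * c) powr (q - 1) \<le> 2 * c powr (q - 1)" .
    have "2 * h powr q / (2 * c powr (q - 1)) \<le> 2 * h powr q / (2 * c) powr (q - 1)"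
      using le c_pos by (intro divide_left_mono) auto
    from divide_right_mono[OF this, of q] show ?thesis
      using q_pos by (simp add: field_simps)
  qed
  finally have young: "h * d \<le> c * d powr p / 2 + 2 / q * h powr q / (2 * c) powr (q - 1)"
    by simp
  have "c / 2 * d powr p \<le> bregman_real \<theta> \<xi> x' x + 2 * e"
    unfolding d_def by (rule bregman_growth[OF x x'])
  moreover have "bregman_real \<theta> \<xi>' z x' = bregman_real \<theta> \<xi> z x - bregman_real \<theta> \<xi> x' x
      + blinfun_apply (\<xi>' - \<xi>) (x' - x) + blinfun_apply (\<xi>' - \<xi>) (x - z)"
    by (simp add: bregman_real_def blinfun.diff_left blinfun.diff_right)
  moreover have "blinfun_apply (\<xi>' - \<xi>) (x' - x) \<le> h * d"
    using norm_blinfun[of "\<xi>' - \<xi>" "x' - x"] by (simp add: h_def d_def)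
  ultimately show ?thesis
    using young unfolding h_def[symmetric] by simp
qed

lemma bregman_real_lower_semicontinuous:
  assumes u: "u \<longlonglongrightarrow> v"
    and le: "\<forall>\<^sub>F k in sequentially. u k \<in> A \<and> bregman_real \<theta> \<xi> (u k) x \<le> C"
  shows "v \<in> A \<and> bregman_real \<theta> \<xi> v x \<le> C"
proof -
  have lim: "(\<lambda>k. C + \<theta> x + \<xi> (u k - x)) \<longlonglongrightarrow> C + \<theta> x + \<xi> (v - x)"
    by (intro tendsto_intros u)
  have key: "v \<in> A \<and> \<theta> v \<le> C + \<theta> x + \<xi> (v - x) + \<delta>" if "\<delta> > 0" for \<delta>
  proof (rule lower_semicontinuity[OF u])
    have "\<forall>\<^sub>F k in sequentially. C + \<theta> x + \<xi> (u k - x) < C + \<theta> x + \<xi> (v - x) + \<delta>"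
      using lim by (rule order_tendstoD) (use that in simp)
    with le show "\<forall>\<^sub>F k in sequentially. u k \<in> A \<and> \<theta> (u k) \<le> C + \<theta> x + \<xi> (v - x) + \<delta>"
      by eventually_elim (auto simp: bregman_real_def)
  qed
  from key[of 1] have "v \<in> A" by simp
  moreover have "\<theta> v \<le> C + \<theta> x + \<xi> (v - x)"
    by (rule field_le_epsilon) (rule key[THEN conjunct2])
  ultimately show ?thesis by (simp add: bregman_real_def)
qed

text \<open>
  The limit of the subsequence is one of the points of \<open>Z\<close>, so the distances to it converge
  along the whole sequence, and it suffices to show that they tend to 0 along the subsequence. This
  follows from lower semicontinuity, because mutual distances within the subsequence are
  uniformly small.
\<close>

lemma convergence_from_subsequence:
  assumes sub: "\<And>n. subgradient (\<epsilon> n) (\<xi> n) (x n)" and eps: "\<epsilon> \<longlonglongrightarrow> 0"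
    and sol: "Z \<subseteq> A" "xdag \<in> Z"
    and conv: "\<And>z. z \<in> Z \<Longrightarrow> convergent (\<lambda>n. bregman_real \<theta> (\<xi> n) z (x n))"
    and n: "strict_mono (n :: nat \<Rightarrow> nat)"
    and small: "\<And>\<delta>. \<delta> > 0 \<Longrightarrow> \<exists>K. \<forall>l\<ge>K. \<forall>k\<ge>l.
                  \<bar>blinfun_apply (\<xi> (n k) - \<xi> (n l)) (x (n k) - xdag)\<bar> \<le> \<delta>"
    and limit_in: "\<And>u. (\<lambda>k. x (n k)) \<longlonglongrightarrow> u \<Longrightarrow> u \<in> A \<Longrightarrow> u \<in> Z"
  shows "\<exists>xstar\<in>Z. x \<longlonglongrightarrow> xstar \<and> (\<lambda>n. bregman_real \<theta> (\<xi> n) xstar (x n)) \<longlonglongrightarrow> 0"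
proof -
  define b where "b = (\<lambda>n. bregman_real \<theta> (\<xi> n) xdag (x n))"
  have xA: "x k \<in> A" for k using sub by (simp add: subgradient_def)
  have "convergent (\<lambda>k. b (n k))"
    using convergent_subseq_convergent[OF conv[OF sol(2)] n] by (simp add: b_def comp_def)
  then have cauchy_b: "Cauchy (\<lambda>k. b (n k))" by (rule convergent_Cauchy)
  have eps_n: "(\<lambda>k. \<epsilon> (n k)) \<longlonglongrightarrow> 0"
    using LIMSEQ_subseq_LIMSEQ[OF eps n] by (simp add: comp_def)
  have mutual: "\<exists>K. \<forall>l\<ge>K. \<forall>k\<ge>l. bregman_real \<theta> (\<xi> (n l)) (x (n k)) (x (n l)) \<le> \<delta>"
    if "\<delta> > 0" for \<delta>
  proof -
    have half: "\<delta> / 2 > 0" using that by simp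
    obtain K1 where K1: "\<And>l k. l \<ge> K1 \<Longrightarrow> k \<ge> l \<Longrightarrow>
        \<bar>blinfun_apply (\<xi> (n k) - \<xi> (n l)) (x (n k) - xdag)\<bar> \<le> \<delta> / 2"
      using small[OF half] by blast
    obtain K2 where K2: "\<And>l k. l \<ge> K2 \<Longrightarrow> k \<ge> K2 \<Longrightarrow> \<bar>b (n l) - b (n k)\<bar> < \<delta> / 2"
      using CauchyD[OF cauchy_b half] by auto
    have "bregman_real \<theta> (\<xi> (n l)) (x (n k)) (x (n l)) \<le> \<delta>"
      if "l \<ge> max K1 K2" "k \<ge> l" for l k
    proof -
      have "bregman_real \<theta> (\<xi> (n l)) (x (n k)) (x (n l)) =
         b (n l) - b (n k) + blinfun_apply (\<xi> (n k) - \<xi> (n l)) (x (n k) - xdag)"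
        unfolding b_def by (rule bregman_real_three_points)
      moreover have "\<bar>blinfun_apply (\<xi> (n k) - \<xi> (n l)) (x (n k) - xdag)\<bar> \<le> \<delta> / 2"
        using K1 that by simp
      moreover have "\<bar>b (n l) - b (n k)\<bar> < \<delta> / 2"
        using K2 that by simp
      ultimately show ?thesis by linarith
    qed
    then show ?thesis by blast
  qed
  have small_powr: "a < \<delta>"
    if "c / 2 * a powr p \<le> C" "C < c / 2 * \<delta> powr p" "a \<ge> 0" "\<delta> > 0" for a C \<delta> :: real
  proof (rule ccontr)
    assume "\<not> a < \<delta>"
    then have "\<delta> powr p \<le> a powr p" using that p_ge_2 by (intro powr_mono2) auto
    then have "c / 2 * \<delta> powr p \<le> c / 2 * a powr p" using c_pos by (intro mult_left_mono) auto
    with that show False by linarith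
  qed
  have "Cauchy (\<lambda>k. x (n k))"
  proof (rule metric_CauchyI)
    fix \<delta> :: real assume "\<delta> > 0"
    define C where "C = c / 2 * \<delta> powr p"
    have C: "C > 0" using c_pos \<open>\<delta> > 0\<close> by (simp add: C_def)
    have C3: "C / 3 > 0" "C / 6 > 0" using C by auto
    obtain K1 where K1: "\<And>l k. l \<ge> K1 \<Longrightarrow> k \<ge> l \<Longrightarrow>
        bregman_real \<theta> (\<xi> (n l)) (x (n k)) (x (n l)) \<le> C / 3"
      using mutual[OF C3(1)] by blast
    obtain K2 where K2: "\<And>l. l \<ge> K2 \<Longrightarrow> \<epsilon> (n l) < C / 6"
      using order_tendstoD(2)[OF eps_n C3(2)] unfolding eventually_sequentially by blast
    have *: "dist (x (n k)) (x (n l)) < \<delta>" if "l \<ge> max K1 K2" "k \<ge> l" for l k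
    proof -
      have "c / 2 * norm (x (n k) - x (n l)) powr p
          \<le> bregman_real \<theta> (\<xi> (n l)) (x (n k)) (x (n l)) + 2 * \<epsilon> (n l)"
        by (rule bregman_growth[OF sub xA])
      also have "\<dots> \<le> C / 3 + 2 * (C / 6)"
        using K1[of l k] K2[of l] that by (intro add_mono mult_left_mono) auto
      finally show ?thesis
        unfolding dist_norm
      proof (rule small_powr)
        show "C / 3 + 2 * (C / 6) < c / 2 * \<delta> powr p"
          unfolding C_def[symmetric] using C by simp
      qed (use \<open>\<delta> > 0\<close> in auto)
    qed
    have "dist (x (n k)) (x (n l)) < \<delta>" if "l \<ge> max K1 K2" "k \<ge> max K1 K2" for l k
      using *[of l k] *[of k l] that by (cases "l \<le> k") (auto simp: dist_commute)
    then show "\<exists>M. \<forall>k\<ge>M. \<forall>l\<ge>M. dist (x (n k)) (x (n l)) < \<delta>" by blast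
  qed
  then obtain xstar where lim: "(\<lambda>k. x (n k)) \<longlonglongrightarrow> xstar"
    using Cauchy_convergent convergent_def by blast
  have near: "\<exists>K. \<forall>l\<ge>K. xstar \<in> A \<and> bregman_real \<theta> (\<xi> (n l)) xstar (x (n l)) \<le> \<delta>" if pos: "\<delta> > 0" for \<delta>
  proof -
    obtain K where K: "\<And>l k. l \<ge> K \<Longrightarrow> k \<ge> l \<Longrightarrow>
        bregman_real \<theta> (\<xi> (n l)) (x (n k)) (x (n l)) \<le> \<delta>"
      using mutual[OF pos] by blast
    have "xstar \<in> A \<and> bregman_real \<theta> (\<xi> (n l)) xstar (x (n l)) \<le> \<delta>" if "l \<ge> K" for l
      by (rule bregman_real_lower_semicontinuous[OF lim])
         (use K[OF that] xA in \<open>auto simp: eventually_sequentially\<close>)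
    then show ?thesis by blast
  qed
  have xstarA: "xstar \<in> A" using near[of 1] by auto
  then have xstar: "xstar \<in> Z" using limit_in[OF lim] by simp
  define b' where "b' = (\<lambda>n. bregman_real \<theta> (\<xi> n) xstar (x n))"
  obtain b\<^sub>0 where b\<^sub>0: "b' \<longlonglongrightarrow> b\<^sub>0"
    using conv[OF xstar] by (auto simp: convergent_def b'_def)
  have sub_lim: "(\<lambda>k. b' (n k)) \<longlonglongrightarrow> b\<^sub>0"
    using LIMSEQ_subseq_LIMSEQ[OF b\<^sub>0 n] by (simp add: comp_def)
  have "b\<^sub>0 \<le> 0"
  proof (rule field_le_epsilon)
    fix \<delta> :: real assume "\<delta> > 0"
    show "b\<^sub>0 \<le> 0 + \<delta>"
      by (rule LIMSEQ_le_const2[OF sub_lim]) (use near[OF \<open>\<delta> > 0\<close>] in \<open>auto simp: b'_def\<close>)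
  qed
  moreover have "0 \<le> b\<^sub>0"
  proof -
    have "(\<lambda>k. - \<epsilon> k) \<longlonglongrightarrow> - 0" by (intro tendsto_minus eps)
    then have "- 0 \<le> b\<^sub>0"
      by (rule LIMSEQ_le[OF _ b\<^sub>0]) (use sub xstarA in \<open>auto simp: b'_def subgradient_def\<close>)
    then show ?thesis by simp
  qed
  ultimately have b'0: "b' \<longlonglongrightarrow> 0" using b\<^sub>0 by simp
  have "x \<longlonglongrightarrow> xstar"
  proof (rule metric_LIMSEQ_I)
    fix \<delta> :: real assume "\<delta> > 0"
    define C where "C = c / 2 * \<delta> powr p"
    have C: "C > 0" using c_pos \<open>\<delta> > 0\<close> by (simp add: C_def)
    have "(\<lambda>n. b' n + 2 * \<epsilon> n) \<longlonglongrightarrow> 0 + 2 * 0"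
      by (intro tendsto_intros b'0 eps)
    then obtain K where K: "\<And>l. l \<ge> K \<Longrightarrow> b' l + 2 * \<epsilon> l < C"
      using order_tendstoD(2)[of "\<lambda>n. b' n + 2 * \<epsilon> n" 0 sequentially C] C
      unfolding eventually_sequentially by auto
    have "dist (x l) xstar < \<delta>" if "l \<ge> K" for l
      unfolding dist_norm norm_minus_commute[of "x l"]
      by (rule small_powr[OF bregman_growth[OF sub xstarA]])
         (use K[OF that] \<open>\<delta> > 0\<close> in \<open>auto simp: C_def b'_def\<close>)
    then show "\<exists>K. \<forall>l\<ge>K. dist (x l) xstar < \<delta>" by blast
  qed
  with xstar b'0 show ?thesis unfolding b'_def by blast
qed

end

section \<open>The tangential cone condition\<close>

lemma norm_le_of_relative_error:
  fixes a b :: "'a::real_normed_vector"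
  assumes "norm (a - b) \<le> \<gamma> * norm a" and "\<gamma> \<le> 1"
  shows "norm b \<le> 2 * norm a"
proof -
  have "norm b \<le> norm a + norm (a - b)"
    using norm_triangle_ineq2[of b a] by (simp add: norm_minus_commute)
  also have "\<dots> \<le> norm a + 1 * norm a"
    using assms mult_right_mono[of \<gamma> 1 "norm a"] by simp
  finally show ?thesis by simp
qed

text \<open>
  A continuous operator family need not be bounded on a ball of an infinite-dimensional space;
  the cone condition is what makes it so. It compares \<open>F z' - F z\<close> and \<open>L z (z' - z)\<close> up to constant
  factors, so the single operator \<open>L a\<close> bounds the oscillation of \<open>F\<close> on the ball, and this
  oscillation bounds every \<open>L z\<close>.
\<close>

lemma tangential_cone_bounds:
  fixes F :: "'a::real_normed_vector \<Rightarrow> 'b::real_normed_vector" and L :: "'a \<Rightarrow> 'a \<Rightarrow>\<^sub>L 'b"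
  assumes r: "r > 0" and \<gamma>: "0 \<le> \<gamma>" "\<gamma> < 1"
    and tcc: "\<And>z' z. z' \<in> cball a r \<Longrightarrow> z \<in> cball a r \<Longrightarrow>
                norm (F z' - F z - L z (z' - z)) \<le> \<gamma> * norm (F z' - F z)"
  shows "\<exists>K\<ge>0. (\<forall>z\<in>cball a r. norm (L z) \<le> K) \<and>
           (\<forall>z'\<in>cball a r. \<forall>z\<in>cball a r. norm (F z' - F z) \<le> K * norm (z' - z))"
proof -
  have a: "a \<in> cball a r" using r by simp
  have upper: "(1 - \<gamma>) * norm (F z' - F z) \<le> norm (L z (z' - z))"
    if "z' \<in> cball a r" "z \<in> cball a r" for z' z
    using tcc[OF that] norm_triangle_ineq2[of "F z' - F z" "L z (z' - z)"] by (simp add: algebra_simps)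
  have lower: "norm (L z (z' - z)) \<le> 2 * norm (F z' - F z)"
    if "z' \<in> cball a r" "z \<in> cball a r" for z' z
    by (rule norm_le_of_relative_error[OF tcc[OF that] less_imp_le[OF \<gamma>(2)]])
  define M where "M = norm (L a) * r / (1 - \<gamma>)"
  have M: "M \<ge> 0" using r \<gamma> by (simp add: M_def)
  have near_a: "norm (F z - F a) \<le> M" if "z \<in> cball a r" for z
  proof -
    have "(1 - \<gamma>) * norm (F z - F a) \<le> norm (L a (z - a))" by (rule upper[OF that a])
    also have "\<dots> \<le> norm (L a) * r"
      using norm_blinfun[of "L a" "z - a"] that
        mult_left_mono[of "norm (z - a)" r "norm (L a)"] by (simp add: dist_norm norm_minus_commute)
    finally show ?thesis using \<gamma> by (simp add: M_def field_simps)
  qed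
  have on_diff: "norm (L z (z' - z)) \<le> 4 * M" if "z' \<in> cball a r" "z \<in> cball a r" for z' z
  proof -
    have "norm (F z' - F z) \<le> 2 * M"
      using near_a[OF that(1)] near_a[OF that(2)] norm_triangle_ineq4[of "F z' - F a" "F z - F a"] by simp
    with lower[OF that] show ?thesis by simp
  qed
  have on_ball: "norm (L z v) \<le> 8 * M" if "z \<in> cball a r" "norm v \<le> r" for z v
  proof -
    \<comment> \<open>Near the boundary \<open>z + v\<close> may leave the ball; both \<open>a + v\<close> and \<open>a\<close> are inside.\<close>
    have "L z v = L z ((a + v) - z) - L z (a - z)"
      by (simp add: blinfun.diff_right blinfun.add_right)
    moreover have "norm (L z ((a + v) - z)) \<le> 4 * M"
      by (rule on_diff) (use that in \<open>auto simp: dist_norm\<close>)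
    ultimately show ?thesis
      using on_diff[OF a that(1)] norm_triangle_ineq4[of "L z ((a + v) - z)" "L z (a - z)"] by simp
  qed
  have L_bound: "norm (L z) \<le> 8 * M / r" if "z \<in> cball a r" for z
  proof (rule norm_blinfun_bound)
    show "0 \<le> 8 * M / r" using M r by simp
    fix v
    show "norm (L z v) \<le> 8 * M / r * norm v"
    proof (cases "v = 0")
      case False
      have "norm (L z ((r / norm v) *\<^sub>R v)) \<le> 8 * M"
        by (rule on_ball) (use that r False in auto)
      then show ?thesis
        using False r by (simp add: blinfun.scaleR_right field_simps)
    qed (simp add: blinfun.zero_right)
  qed
  define K where "K = 8 * M / r / (1 - \<gamma>)"
  have K: "8 * M / r \<le> K"
    unfolding K_def using M r \<gamma> by (simp add: pos_le_divide_eq mult_left_le)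
  have "norm (F z' - F z) \<le> K * norm (z' - z)" if "z' \<in> cball a r" "z \<in> cball a r" for z' z
  proof -
    have "(1 - \<gamma>) * norm (F z' - F z) \<le> norm (L z (z' - z))" by (rule upper[OF that])
    also have "\<dots> \<le> norm (L z) * norm (z' - z)" by (rule norm_blinfun)
    also have "\<dots> \<le> 8 * M / r * norm (z' - z)"
      by (intro mult_right_mono L_bound that) simp
    also have "8 * M / r * norm (z' - z) = (1 - \<gamma>) * (K * norm (z' - z))"
      using \<gamma> by (simp add: K_def)
    finally show ?thesis
      using \<gamma> by simp
  qed
  moreover have "K \<ge> 0" unfolding K_def using M r \<gamma> by simp
  moreover have "norm (L z) \<le> K" if "z \<in> cball a r" for z
    using L_bound[OF that] K by linarith
  ultimately show ?thesis by blast
qed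

section \<open>The step size rule\<close>

text \<open>
  The real numbers \<open>r\<close> and \<open>g\<close> stand for the norms of the residual and of the adjoint applied to its
  duality mapping, \<open>e\<close> for the current tolerance. The quantity \<open>P\<close> below is the natural scale of a step: it
  is positive even when the residual vanishes.
\<close>

locale step_rule =
  fixes p q s \<beta>\<^sub>0 \<beta>\<^sub>1 \<sigma> e r g :: real
  assumes p_gt_1: "p > 1" and conjugate: "1 / p + 1 / q = 1" and s_gt_1: "s > 1"
    and \<beta>\<^sub>0_pos: "\<beta>\<^sub>0 > 0" and \<beta>\<^sub>1_pos: "\<beta>\<^sub>1 > 0" and \<sigma>_pos: "\<sigma> > 0" and e_pos: "e > 0"
    and r_nonneg: "r \<ge> 0" and g_nonneg: "g \<ge> 0"
begin

abbreviation P where "P \<equiv> r powr p + \<sigma> * e"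
abbreviation mt where "mt \<equiv> step_tilde p s \<beta>\<^sub>0 \<beta>\<^sub>1 r g"
abbreviation \<mu> where "\<mu> \<equiv> step_size p s \<beta>\<^sub>0 \<beta>\<^sub>1 \<sigma> e r g"

lemma P_pos: "P > 0" and r_powr_le_P: "r powr p \<le> P"
  using \<sigma>_pos e_pos by (auto intro: add_nonneg_pos)

lemma mt_nonneg: "mt \<ge> 0" and mt_le: "mt \<le> \<beta>\<^sub>1"
  using \<beta>\<^sub>0_pos \<beta>\<^sub>1_pos by (auto simp: step_tilde_def)

lemma \<mu>_nonneg: "\<mu> \<ge> 0"
  using mt_nonneg by (simp add: step_size_def)

lemma r_powr_le: "r powr a \<le> P powr (a / p)" if "a \<ge> 0"
proof -
  have "r powr a = (r powr p) powr (a / p)"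
    using p_gt_1 by (simp add: powr_powr)
  also have "\<dots> \<le> P powr (a / p)"
    using r_powr_le_P that p_gt_1 by (intro powr_mono2) auto
  finally show ?thesis .
qed

lemma step_size_bound: "\<mu> * r powr (s - 1) \<le> \<beta>\<^sub>1 * P powr ((p - 1) / p)"
proof -
  have "\<mu> * r powr (s - 1) \<le> (\<beta>\<^sub>1 * P powr (1 - s / p)) * P powr ((s - 1) / p)"
    unfolding step_size_def using mt_le \<beta>\<^sub>1_pos s_gt_1
    by (intro mult_mono r_powr_le mult_right_mono) auto
  also have "\<dots> = \<beta>\<^sub>1 * P powr (1 - s / p + (s - 1) / p)"
    by (simp only: powr_add mult.assoc)
  also have "1 - s / p + (s - 1) / p = (p - 1) / p"
    using p_gt_1 by (simp add: field_simps)
  finally show ?thesis .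
qed

lemma q_gt_1: "q > 1" and q_minus_1: "q - 1 = q / p"
proof -
  have q1: "1 / q = 1 - 1 / p" using conjugate by simp
  have "1 / q > 0" "1 / q < 1" unfolding q1 using p_gt_1 by auto
  then show q: "q > 1"
    by (smt (verit) divide_le_0_iff divide_less_eq_1_pos)
  show "q - 1 = q / p"
    using conjugate q p_gt_1 by (simp add: field_simps)
qed

text \<open>
  The minimum in the definition of the step size serves exactly this estimate: it bounds the power
  of the update direction, which may be large, by a power of the residual.
\<close>

lemma mt_powr: "mt powr (q - 1) * g powr q \<le> \<beta>\<^sub>0 powr (q - 1) * r powr (q * (s - 1))"
proof (cases "g = 0")
  case False
  then have g: "g > 0" using g_nonneg by simp
  have "mt \<le> \<beta>\<^sub>0 * r powr (p * (s - 1)) / g powr p"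
    using False by (simp add: step_tilde_def)
  then have "mt powr (q - 1) \<le> (\<beta>\<^sub>0 * r powr (p * (s - 1)) / g powr p) powr (q - 1)"
    using mt_nonneg q_gt_1 by (intro powr_mono2) auto
  also have "\<dots> = \<beta>\<^sub>0 powr (q - 1) * r powr (p * (s - 1) * (q - 1)) / g powr (p * (q - 1))"
    using \<beta>\<^sub>0_pos by (simp add: powr_divide powr_mult powr_powr)
  also have "p * (q - 1) = q" unfolding q_minus_1 using p_gt_1 by simp
  also have "p * (s - 1) * (q - 1) = q * (s - 1)" unfolding q_minus_1 using p_gt_1 by simp
  finally show ?thesis using g by (simp add: field_simps)
qed simp

text \<open>
  Exponent bookkeeping for conjugate exponents. It is needed with \<open>P\<close> or with \<open>r powr p\<close> in place
  of \<open>x\<close>, depending on which of the two dominates the factor with exponent \<open>1 - s / p\<close>.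
\<close>

lemma powr_product: "x powr ((1 - s / p) * (q - 1)) * x powr (q * (s - 1) / p) = x powr (s / p)"
proof -
  have "(1 - s / p) * (q - 1) + q * (s - 1) / p = s / p"
    using p_gt_1 q_minus_1 by (simp add: field_simps)
  then show ?thesis by (simp only: powr_add[symmetric])
qed

text \<open>
  The energy of a step, a power of the length of the dual increment, is paid for by the decrease
  \<open>\<mu> * r powr s\<close> of the Bregman distance. If \<open>p < s\<close>, the factor \<open>P powr (1 - s / p)\<close> decreases in \<open>P\<close>,
  so \<open>P\<close> may be replaced by \<open>r powr p\<close> at once. If \<open>s \<le> p\<close>, the estimate is in terms of \<open>P\<close>, and
  \<open>\<beta>\<^sub>1 * \<sigma> \<le> 1\<close> makes the contribution of the tolerance to \<open>P\<close> at most \<open>e\<close>.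
\<close>

lemma step_energy:
  assumes small: "s \<le> p \<Longrightarrow> \<beta>\<^sub>1 * \<sigma> \<le> 1"
  shows "(\<mu> * g) powr q \<le> \<beta>\<^sub>0 powr (q - 1) * (\<mu> * r powr s + e)"
proof -
  define E where "E = P powr ((1 - s / p) * (q - 1)) * r powr (q * (s - 1))"
  have "(\<mu> * g) powr q = \<mu> * (\<mu> powr (q - 1) * g powr q)"
    using \<mu>_nonneg g_nonneg q_gt_1 powr_add[of \<mu> 1 "q - 1"] by (simp add: powr_mult)
  also have "\<mu> powr (q - 1) = mt powr (q - 1) * P powr ((1 - s / p) * (q - 1))"
    using mt_nonneg by (simp add: step_size_def powr_mult powr_powr)
  also have "\<mu> * (mt powr (q - 1) * P powr ((1 - s / p) * (q - 1)) * g powr q)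
      = \<mu> * P powr ((1 - s / p) * (q - 1)) * (mt powr (q - 1) * g powr q)"
    by simp
  also have "\<dots> \<le> \<mu> * P powr ((1 - s / p) * (q - 1)) * (\<beta>\<^sub>0 powr (q - 1) * r powr (q * (s - 1)))"
    using mt_powr \<mu>_nonneg by (intro mult_left_mono) auto
  also have "\<dots> = \<beta>\<^sub>0 powr (q - 1) * (\<mu> * E)"
    by (simp add: E_def)
  finally have "(\<mu> * g) powr q \<le> \<beta>\<^sub>0 powr (q - 1) * (\<mu> * E)" .
  moreover have "\<mu> * E \<le> \<mu> * r powr s + e"
  proof (cases "s \<le> p")
    case True
    have "E \<le> P powr ((1 - s / p) * (q - 1)) * P powr (q * (s - 1) / p)"
      unfolding E_def using r_powr_le[of "q * (s - 1)"] q_gt_1 s_gt_1 by (intro mult_left_mono) auto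
    then have "\<mu> * E \<le> \<mu> * P powr (s / p)"
      unfolding powr_product using \<mu>_nonneg by (rule mult_left_mono)
    also have "\<dots> = mt * P powr (1 - s / p + s / p)"
      unfolding step_size_def powr_add by simp
    also have "\<dots> = mt * P" using P_pos by simp
    also have "\<dots> = mt * r powr p + mt * \<sigma> * e" by (simp add: algebra_simps)
    also have "\<dots> \<le> \<mu> * r powr s + e"
    proof (rule add_mono)
      have "r powr p = r powr (p - s) * r powr s"
        by (simp flip: powr_add)
      also have "\<dots> \<le> P powr ((p - s) / p) * r powr s"
        using True by (intro mult_right_mono r_powr_le) auto
      also have "(p - s) / p = 1 - s / p" using p_gt_1 by (simp add: field_simps)
      finally show "mt * r powr p \<le> \<mu> * r powr s"
        unfolding step_size_def mult.assoc using mt_nonneg by (rule mult_left_mono)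
      have "mt * \<sigma> \<le> \<beta>\<^sub>1 * \<sigma>" using mt_le \<sigma>_pos by simp
      also have "\<dots> \<le> 1" using small True by simp
      finally show "mt * \<sigma> * e \<le> e" using e_pos by simp
    qed
    finally show ?thesis .
  next
    case False
    have "E \<le> r powr s"
    proof (cases "r = 0")
      case False
      then have r: "r > 0" using r_nonneg by simp
      have "P powr ((1 - s / p) * (q - 1)) \<le> (r powr p) powr ((1 - s / p) * (q - 1))"
      proof (rule powr_mono2')
        show "(1 - s / p) * (q - 1) \<le> 0"
          using \<open>\<not> s \<le> p\<close> p_gt_1 q_gt_1 by (intro mult_nonpos_nonneg) auto
      qed (use r r_powr_le_P in auto)
      then have "E \<le> (r powr p) powr ((1 - s / p) * (q - 1)) * r powr (q * (s - 1))"
        unfolding E_def by (rule mult_right_mono) simp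
      also have "r powr (q * (s - 1)) = (r powr p) powr (q * (s - 1) / p)"
        using p_gt_1 by (simp add: powr_powr)
      also have "(r powr p) powr ((1 - s / p) * (q - 1)) * \<dots> = (r powr p) powr (s / p)"
        by (rule powr_product)
      also have "\<dots> = r powr s" using p_gt_1 by (simp add: powr_powr)
      finally show ?thesis .
    qed (simp add: E_def)
    then have "\<mu> * E \<le> \<mu> * r powr s" using \<mu>_nonneg by (rule mult_left_mono)
    with e_pos show ?thesis by linarith
  qed
  ultimately show ?thesis
    by (smt (verit) mult_left_mono powr_ge_zero)
qed

text \<open>
  Summability of the decreases gives summability of \<open>r powr p\<close>: either the residual is dominated by the tolerance,
  or \<open>P\<close> is comparable to \<open>r powr p\<close>, and then the bound on \<open>g\<close> keeps the step size from degenerating.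
\<close>

lemma residual_bound:
  assumes B: "B > 0" and g: "g \<le> B * r powr (s - 1)"
  shows "r powr p \<le> 2 powr (s / p) / min (\<beta>\<^sub>0 / B powr p) \<beta>\<^sub>1 * (\<mu> * r powr s) + \<sigma> * e"
proof -
  define m where "m = min (\<beta>\<^sub>0 / B powr p) \<beta>\<^sub>1"
  have m: "m > 0" using \<beta>\<^sub>0_pos \<beta>\<^sub>1_pos B by (simp add: m_def)
  have mt: "m \<le> mt"
  proof (cases "g = 0")
    case False
    then have g0: "g > 0" using g_nonneg by simp
    have "g powr p \<le> (B * r powr (s - 1)) powr p"
      using g g0 p_gt_1 by (intro powr_mono2) auto
    also have "\<dots> = B powr p * r powr (p * (s - 1))"
      using B by (simp add: powr_mult powr_powr mult.commute)
    finally have "\<beta>\<^sub>0 / B powr p \<le> \<beta>\<^sub>0 * r powr (p * (s - 1)) / g powr p"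
      using g0 B \<beta>\<^sub>0_pos by (simp add: field_simps)
    then show ?thesis using False by (auto simp: step_tilde_def m_def)
  qed (simp add: step_tilde_def m_def)
  show ?thesis
  proof (cases "r powr p \<le> \<sigma> * e")
    case True
    have "0 \<le> 2 powr (s / p) / m * (\<mu> * r powr s)" using m \<mu>_nonneg by simp
    with True show ?thesis unfolding m_def by linarith
  next
    case False
    then have r: "r > 0" using r_nonneg \<sigma>_pos e_pos by (cases "r = 0") auto
    have "2 powr (- (s / p)) * r powr (p - s) \<le> P powr (1 - s / p)"
    proof (cases "s \<le> p")
      case True
      have "2 powr (- (s / p)) * r powr (p - s) \<le> 1 * P powr ((p - s) / p)"
        using True s_gt_1 p_gt_1 powr_mono[of "- (s / p)" 0 "2::real"]
        by (intro mult_mono r_powr_le) auto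
      also have "(p - s) / p = 1 - s / p" using p_gt_1 by (simp add: field_simps)
      finally show ?thesis by simp
    next
      case s: False
      have "2 powr (- (s / p)) * r powr (p - s) \<le> 2 powr (1 - s / p) * r powr (p - s)"
        by (intro mult_right_mono powr_mono) auto
      also have "\<dots> = (2 * r powr p) powr (1 - s / p)"
        using r p_gt_1 by (simp add: powr_mult powr_powr algebra_simps)
      also have "\<dots> \<le> P powr (1 - s / p)"
        by (rule powr_mono2') (use s False P_pos p_gt_1 in auto)
      finally show ?thesis .
    qed
    then have "m * (2 powr (- (s / p)) * r powr (p - s)) \<le> \<mu>"
      unfolding step_size_def using mt m mt_nonneg by (intro mult_mono) auto
    then have "m * (2 powr (- (s / p)) * r powr (p - s)) * r powr s \<le> \<mu> * r powr s"
      by (rule mult_right_mono) simp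
    moreover have "m * (2 powr (- (s / p)) * r powr (p - s)) * r powr s = m / 2 powr (s / p) * r powr p"
      by (simp add: powr_minus_divide powr_add[symmetric])
    ultimately have "m / 2 powr (s / p) * r powr p \<le> \<mu> * r powr s"
      by (simp only:)
    from mult_left_mono[OF this, of "2 powr (s / p) / m"]
    have "r powr p \<le> 2 powr (s / p) / m * (\<mu> * r powr s)"
      using m by simp
    then show ?thesis using \<sigma>_pos e_pos unfolding m_def by (smt (verit) mult_pos_pos)
  qed
qed

end

section \<open>Residuals along cycles of a Kaczmarz method\<close>

lemma record_minima:
  fixes Q :: "nat \<Rightarrow> real"
  assumes pos: "\<And>n. Q n > 0" and lim: "Q \<longlonglongrightarrow> 0"
  shows "\<exists>n :: nat \<Rightarrow> nat. strict_mono n \<and> (\<forall>k. \<forall>j\<le>n k. Q (n k) \<le> Q j)"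
proof -
  define R where "R = {k. \<forall>j\<le>k. Q k \<le> Q j}"
  have "\<exists>k>M. k \<in> R" for M
  proof -
    define c where "c = Min (Q ` {..M})"
    have c: "c > 0" and le_c: "\<And>j. j \<le> M \<Longrightarrow> c \<le> Q j"
      using pos by (auto simp: c_def)
    have "\<exists>k. Q k < c"
      using order_tendstoD(2)[OF lim c] by (auto simp: eventually_sequentially)
    \<comment> \<open>The first index at which \<open>Q\<close> falls below its minimum over \<open>{..M}\<close>.\<close>
    define k where "k = (LEAST k. Q k < c)"
    have k: "Q k < c" unfolding k_def by (rule LeastI_ex) fact
    have before: "c \<le> Q j" if "j < k" for j
      using not_less_Least[of j "\<lambda>k. Q k < c"] that by (simp add: k_def)
    have "k \<in> R"
    proof -
      have "Q k \<le> Q j" if "j \<le> k" for j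
        using before[of j] k that by (cases "j = k") auto
      then show ?thesis by (simp add: R_def)
    qed
    moreover have "k > M" using le_c[of k] k by force
    ultimately show ?thesis by blast
  qed
  then have "infinite R" by (auto simp: infinite_nat_iff_unbounded)
  then obtain n :: "nat \<Rightarrow> nat" where "strict_mono n" "\<And>k. n k \<in> R"
    using infinite_enumerate by blast
  then show ?thesis unfolding R_def by blast
qed

lemma exists_index_mod:
  fixes N i n :: nat
  assumes "i < N"
  shows "\<exists>j<N. (n + j) mod N = i"
proof (intro exI conjI)
  have "(n + (i + N - n mod N) mod N) mod N = (n mod N + (i + N - n mod N)) mod N"
    by (simp add: mod_simps)
  also have "n mod N + (i + N - n mod N) = i + N"
    using assms by (simp add: le_add_diff_inverse less_imp_le trans_le_add2)
  finally show "(n + (i + N - n mod N) mod N) mod N = i" using assms by simp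
qed (use assms in simp)

text \<open>
  What is left of the iteration once the geometry has been used: up to constants, the
  numbers \<open>T n\<close> bound the residual of the equation treated at step \<open>n\<close> and the length of the step, and their
  powers \<open>T n powr (p - 1)\<close> bound the size of the dual increment.
\<close>

locale kaczmarz_sequence =
  fixes N :: nat and p K :: real and T :: "nat \<Rightarrow> real"
    and x :: "nat \<Rightarrow> 'a::real_normed_vector" and \<xi> :: "nat \<Rightarrow> 'a \<Rightarrow>\<^sub>L real"
    and res :: "nat \<Rightarrow> 'a \<Rightarrow> real" and xdag :: 'a
  assumes N: "N \<ge> 1" and p_ge_1: "p \<ge> 1" and K_nonneg: "K \<ge> 0"
    and T_pos: "\<And>n. T n > 0" and T_summable: "summable (\<lambda>n. T n powr p)"
    and res_nonneg: "\<And>i u. res i u \<ge> 0"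
    and res_lipschitz: "\<And>i m n. i < N \<Longrightarrow> res i (x m) \<le> res i (x n) + K * norm (x m - x n)"
    and res_active: "\<And>n. res (n mod N) (x n) \<le> T n"
    and increment: "\<And>n. norm (x (Suc n) - x n) \<le> K * T n"
    and dual_increment: "\<And>n k. \<bar>blinfun_apply (\<xi> (Suc n) - \<xi> n) (x k - xdag)\<bar>
                          \<le> K * T n powr (p - 1) * (T n + res (n mod N) (x k))"
begin

text \<open>
  The window starts at an arbitrary index; any \<open>N\<close> consecutive steps treat every equation once.
\<close>

definition Q :: "nat \<Rightarrow> real" where
  "Q n = (\<Sum>j<N. T (n + j))"

lemma T_le_Q: "j < N \<Longrightarrow> T (n + j) \<le> Q n"
  unfolding Q_def using T_pos by (intro member_le_sum) (auto simp: less_imp_le)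

lemma Q_pos: "Q n > 0"
  using T_le_Q[of 0 n] T_pos[of n] N by simp

lemma T_tendsto_0: "T \<longlonglongrightarrow> 0"
proof -
  have "(\<lambda>n. (T n powr p) powr (1 / p)) \<longlonglongrightarrow> 0 powr (1 / p)"
    using summable_LIMSEQ_zero[OF T_summable] p_ge_1 by (intro tendsto_powr') auto
  moreover have "(T n powr p) powr (1 / p) = T n" for n
    using T_pos[of n] p_ge_1 by (simp add: powr_powr)
  ultimately show ?thesis by simp
qed

lemma Q_tendsto_0: "Q \<longlonglongrightarrow> 0"
proof -
  have "(\<lambda>n. \<Sum>j<N. T (n + j)) \<longlonglongrightarrow> (\<Sum>j<N. 0)"
    by (intro tendsto_sum LIMSEQ_ignore_initial_segment T_tendsto_0)
  then show ?thesis by (simp add: Q_def[abs_def])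
qed

lemma Q_summable: "summable (\<lambda>n. Q n powr p)"
proof (rule summable_comparison_test')
  show "summable (\<lambda>n. real N powr p * (\<Sum>j<N. T (n + j) powr p))"
    by (intro summable_mult summable_sum summable_ignore_initial_segment T_summable)
  fix n
  define M where "M = Max ((\<lambda>j. T (n + j)) ` {..<N})"
  have "M \<in> (\<lambda>j. T (n + j)) ` {..<N}"
    unfolding M_def using N by (intro Max_in) (auto simp: lessThan_empty_iff)
  then obtain j where j: "j < N" "M = T (n + j)" by auto
  have "Q n \<le> (\<Sum>j<N. M)"
    unfolding Q_def M_def by (intro sum_mono Max_ge) auto
  then have "Q n powr p \<le> (real N * M) powr p"
    using Q_pos[of n] p_ge_1 by (intro powr_mono2) auto
  also have "\<dots> = real N powr p * M powr p"
    using j T_pos by (simp add: powr_mult)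
  also have "M powr p \<le> (\<Sum>j<N. T (n + j) powr p)"
    unfolding j by (rule member_le_sum[of j]) (use j in auto)
  finally show "norm (Q n powr p) \<le> real N powr p * (\<Sum>j<N. T (n + j) powr p)"
    by (simp add: mult_left_mono)
qed

text \<open>
  Equation \<open>i\<close> is treated within the next \<open>N\<close> steps, with residual at most \<open>Q n\<close> there, and the iterate
  moves by at most \<open>K * Q n\<close> until then.
\<close>

lemma res_le_Q: "i < N \<Longrightarrow> res i (x n) \<le> (1 + K\<^sup>2) * Q n"
proof -
  assume i: "i < N"
  obtain j where j: "j < N" "(n + j) mod N = i" using exists_index_mod[OF i] by blast
  have "norm (x (n + k) - x n) \<le> (\<Sum>l<k. K * T (n + l))" for k
  proof (induction k)
    case (Suc k)
    have "norm (x (n + Suc k) - x n) \<le> norm (x (n + Suc k) - x (n + k)) + norm (x (n + k) - x n)"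
      using norm_triangle_ineq[of "x (n + Suc k) - x (n + k)" "x (n + k) - x n"] by simp
    with Suc increment[of "n + k"] show ?case by simp
  qed simp
  also have "(\<Sum>l<j. K * T (n + l)) \<le> (\<Sum>l<N. K * T (n + l))"
    using j K_nonneg T_pos by (intro sum_mono2) (auto simp: less_imp_le)
  also have "\<dots> = K * Q n" by (simp add: Q_def sum_distrib_left)
  finally have "norm (x n - x (n + j)) \<le> K * Q n" by (simp add: norm_minus_commute)
  then have "K * norm (x n - x (n + j)) \<le> K * (K * Q n)" using K_nonneg by (rule mult_left_mono)
  moreover have "res i (x (n + j)) \<le> Q n"
    using res_active[of "n + j"] T_le_Q[OF j(1), of n] j(2) by simp
  ultimately show ?thesis
    using res_lipschitz[OF i, of n "n + j"] by (simp add: algebra_simps power2_eq_square)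
qed

lemma res_tendsto_0: "(\<lambda>n. res i (x n)) \<longlonglongrightarrow> 0" if "i < N"
proof (rule tendsto_sandwich[of "\<lambda>_. 0"])
  show "(\<lambda>n. (1 + K\<^sup>2) * Q n) \<longlonglongrightarrow> 0"
    using tendsto_mult_right_zero[OF Q_tendsto_0] .
qed (use res_nonneg res_le_Q[OF that] in auto)

text \<open>
  Between two record indices \<open>n l\<close> and \<open>n k\<close> of \<open>Q\<close> the residuals at \<open>x (n k)\<close> are at most a multiple of
  \<open>Q m\<close> for every earlier \<open>m\<close>, so each summand of the telescoping sum is at most a multiple of \<open>Q m powr p\<close>,
  the general term of a convergent series.
\<close>

lemma dual_cauchy_along_record_minima:
  "\<exists>n :: nat \<Rightarrow> nat. strict_mono n \<and> (\<forall>\<delta>>0. \<exists>M. \<forall>l\<ge>M. \<forall>k\<ge>l.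
         \<bar>blinfun_apply (\<xi> (n k) - \<xi> (n l)) (x (n k) - xdag)\<bar> \<le> \<delta>)"
proof -
  obtain n :: "nat \<Rightarrow> nat" where n: "strict_mono n" and rec: "\<And>k j. j \<le> n k \<Longrightarrow> Q (n k) \<le> Q j"
    using record_minima[OF Q_pos Q_tendsto_0] by blast
  define f where "f m = K * (2 + K\<^sup>2) * Q m powr p" for m
  have f: "summable f" unfolding f_def by (intro summable_mult Q_summable)
  have pairing: "\<bar>blinfun_apply (\<xi> (n k) - \<xi> (n l)) (x (n k) - xdag)\<bar> \<le> sum f {n l..<n k}" if "l \<le> k" for k l
  proof -
    have le: "n l \<le> n k" using n that by (simp add: strict_mono_less_eq)
    have "\<xi> (n k) - \<xi> (n l) = (\<Sum>m\<in>{n l..<n k}. \<xi> (Suc m) - \<xi> m)"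
      using sum_Suc_diff'[OF le, of \<xi>] by simp
    then have "\<bar>blinfun_apply (\<xi> (n k) - \<xi> (n l)) (x (n k) - xdag)\<bar>
        = \<bar>\<Sum>m\<in>{n l..<n k}. blinfun_apply (\<xi> (Suc m) - \<xi> m) (x (n k) - xdag)\<bar>"
      by (simp add: blinfun.sum_left)
    also have "\<dots> \<le> (\<Sum>m\<in>{n l..<n k}. \<bar>blinfun_apply (\<xi> (Suc m) - \<xi> m) (x (n k) - xdag)\<bar>)"
      by (rule sum_abs)
    also have "\<dots> \<le> sum f {n l..<n k}"
    proof (rule sum_mono)
      fix m assume m: "m \<in> {n l..<n k}"
      have T: "T m \<le> Q m" using T_le_Q[of 0 m] N by simp
      have "res (m mod N) (x (n k)) \<le> (1 + K\<^sup>2) * Q (n k)"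
        using N by (intro res_le_Q) simp
      also have "\<dots> \<le> (1 + K\<^sup>2) * Q m"
        using rec[of m k] m by (intro mult_left_mono) auto
      finally have "T m + res (m mod N) (x (n k)) \<le> (2 + K\<^sup>2) * Q m"
        using T by (simp add: algebra_simps)
      moreover have "T m powr (p - 1) \<le> Q m powr (p - 1)"
        using T T_pos[of m] p_ge_1 by (intro powr_mono2) auto
      ultimately have "K * T m powr (p - 1) * (T m + res (m mod N) (x (n k)))
          \<le> K * Q m powr (p - 1) * ((2 + K\<^sup>2) * Q m)"
        using K_nonneg T_pos[of m] res_nonneg[of "m mod N" "x (n k)"]
        by (intro mult_mono mult_left_mono mult_nonneg_nonneg add_nonneg_nonneg) auto
      also have "\<dots> = f m"
        using Q_pos[of m] powr_add[of "Q m" "p - 1" 1] by (simp add: f_def)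
      finally show "\<bar>blinfun_apply (\<xi> (Suc m) - \<xi> m) (x (n k) - xdag)\<bar> \<le> f m"
        using dual_increment[of m "n k"] by linarith
    qed
    finally show ?thesis .
  qed
  have "\<exists>M. \<forall>l\<ge>M. \<forall>k\<ge>l. \<bar>blinfun_apply (\<xi> (n k) - \<xi> (n l)) (x (n k) - xdag)\<bar> \<le> \<delta>"
    if \<delta>: "\<delta> > 0" for \<delta>
  proof -
    obtain M where M: "\<And>m k. m \<ge> M \<Longrightarrow> norm (sum f {m..<k}) < \<delta>"
      using f[unfolded summable_Cauchy] \<delta> by blast
    have "\<bar>blinfun_apply (\<xi> (n k) - \<xi> (n l)) (x (n k) - xdag)\<bar> \<le> \<delta>" if "l \<ge> M" "k \<ge> l" for k l
      using pairing[OF that(2)] M[of "n l" "n k"] strict_mono_imp_increasing[OF n, of l] that by simp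
    then show ?thesis by blast
  qed
  with n show ?thesis by blast
qed

end

section \<open>Adjoints applied to the duality mapping\<close>

lemma abs_le_dual_norm_on:
  assumes S: "subspace S" and \<zeta>: "\<zeta> \<in> dual_on S" and v: "v \<in> S"
  shows "\<bar>\<zeta> v\<bar> \<le> dual_norm_on S \<zeta> * norm v"
proof -
  from \<zeta> obtain K where K: "\<And>y. y \<in> S \<Longrightarrow> \<bar>\<zeta> y\<bar> \<le> K * norm y"
    unfolding dual_on_def by blast
  have scale: "\<zeta> (a *\<^sub>R y) = a * \<zeta> y" if "y \<in> S" for a y
    using \<zeta> that unfolding dual_on_def by blast
  have bdd: "bdd_above ((\<lambda>y. \<bar>\<zeta> y\<bar>) ` {y \<in> S. norm y \<le> 1})"
  proof (rule bdd_aboveI2)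
    fix y assume y: "y \<in> {y \<in> S. norm y \<le> 1}"
    have "\<bar>\<zeta> y\<bar> \<le> K * norm y" using K y by blast
    also have "\<dots> \<le> \<bar>K\<bar> * 1" using y by (intro mult_mono) auto
    finally show "\<bar>\<zeta> y\<bar> \<le> \<bar>K\<bar>" by simp
  qed
  show ?thesis
  proof (cases "v = 0")
    case True
    then show ?thesis using K[OF v] by simp
  next
    case False
    have "inverse (norm v) *\<^sub>R v \<in> {y \<in> S. norm y \<le> 1}"
      using v False S by (simp add: subspace_scale)
    then have "\<bar>\<zeta> (inverse (norm v) *\<^sub>R v)\<bar> \<le> dual_norm_on S \<zeta>"
      unfolding dual_norm_on_def by (rule cSUP_upper[OF _ bdd])
    then have "\<bar>\<zeta> v\<bar> / norm v \<le> dual_norm_on S \<zeta>"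
      using scale[OF v] by (simp add: abs_mult divide_inverse mult.commute)
    then show ?thesis
      using False by (simp add: pos_divide_le_eq)
  qed
qed

text \<open>
  All that the method uses of the selected element \<open>j\<close> of the duality mapping: testing the update
  direction costs one factor \<open>norm r powr (s - 1)\<close>, and on a vector \<open>h\<close> whose linearised image is
  close to the residual \<open>r\<close>, a fixed fraction of \<open>j r = norm r powr s\<close> survives.
\<close>

lemma duality_map_adjoint:
  assumes Y: "subspace Y" and j: "j \<in> duality_map_on Y s r" and A: "range (blinfun_apply A) \<subseteq> Y"
  shows norm_adjoint_duality_le: "norm (adjoint_apply A j) \<le> norm A * norm r powr (s - 1)"
    and abs_adjoint_duality_le: "\<bar>adjoint_apply A j h\<bar> \<le> norm r powr (s - 1) * norm (A h)"
    and adjoint_duality_ge: "r \<in> Y \<Longrightarrow> norm (r - A h) \<le> \<gamma> * norm r \<Longrightarrow>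
           adjoint_apply A j h \<ge> (1 - \<gamma>) * norm r powr s"
proof -
  have jd: "j \<in> dual_on Y" and jn: "dual_norm_on Y j = norm r powr (s - 1)" and jr: "j r = norm r powr s"
    using j by (auto simp: duality_map_on_def)
  have AY: "A h \<in> Y" for h using A by blast
  have app: "adjoint_apply A j h = j (A h)" for h
    by (rule blinfun_apply_adjoint_apply[OF jd A])
  have bound: "\<bar>j v\<bar> \<le> norm r powr (s - 1) * norm v" if "v \<in> Y" for v
    using abs_le_dual_norm_on[OF Y jd that] by (simp add: jn)
  show le: "\<bar>adjoint_apply A j h\<bar> \<le> norm r powr (s - 1) * norm (A h)" for h
    unfolding app by (rule bound[OF AY])
  show "norm (adjoint_apply A j) \<le> norm A * norm r powr (s - 1)"
  proof (rule norm_blinfun_bound)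
    fix h
    have "norm r powr (s - 1) * norm (A h) \<le> norm r powr (s - 1) * (norm A * norm h)"
      by (intro mult_left_mono norm_blinfun) simp
    with le[of h] show "norm (adjoint_apply A j h) \<le> norm A * norm r powr (s - 1) * norm h"
      by (simp add: ac_simps)
  qed simp
  assume r: "r \<in> Y" and close: "norm (r - A h) \<le> \<gamma> * norm r"
  have diff: "r - A h \<in> Y" using Y r AY by (rule subspace_diff)
  have "j ((r - A h) + A h) = j (r - A h) + j (A h)"
    using jd diff AY unfolding dual_on_def by blast
  then have split: "j (A h) = j r - j (r - A h)" by simp
  have "j (r - A h) \<le> norm r powr (s - 1) * (\<gamma> * norm r)"
    using bound[OF diff] mult_left_mono[OF close, of "norm r powr (s - 1)"] by simp
  also have "\<dots> = \<gamma> * norm r powr s"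
    using powr_add[of "norm r" "s - 1" 1] by simp
  finally show "adjoint_apply A j h \<ge> (1 - \<gamma>) * norm r powr s"
    unfolding app split jr by (simp add: algebra_simps)
qed

section \<open>Descent of the Bregman distance\<close>

lemma (in p_convex_function) landweber_step_descent:
  assumes step: "step_rule p q s \<beta>\<^sub>0 \<beta>\<^sub>1 \<sigma> e r (norm g)"
    and small: "s \<le> p \<Longrightarrow> \<beta>\<^sub>1 * \<sigma> \<le> 1"
    and C: "2 / q * (\<beta>\<^sub>0 / (2 * c)) powr (q - 1) \<le> 1"
    and x: "subgradient e \<xi> x" and x': "x' \<in> A"
    and \<mu>: "\<mu> = step_size p s \<beta>\<^sub>0 \<beta>\<^sub>1 \<sigma> e r (norm g)"
    and \<xi>': "\<xi>' = \<xi> - \<mu> *\<^sub>R g"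
    and pairing: "(1 - \<gamma>) * r powr s \<le> blinfun_apply g (x - z)"
  shows "bregman_real \<theta> \<xi>' z x'
     \<le> bregman_real \<theta> \<xi> z x - (1 - \<gamma> - 2 / q * (\<beta>\<^sub>0 / (2 * c)) powr (q - 1)) * (\<mu> * r powr s) + 3 * e"
proof -
  interpret step_rule p q s \<beta>\<^sub>0 \<beta>\<^sub>1 \<sigma> e r "norm g" by (rule step)
  define C' where "C' = 2 / q * (\<beta>\<^sub>0 / (2 * c)) powr (q - 1)"
  have \<mu>0: "\<mu> \<ge> 0" unfolding \<mu> by (rule \<mu>_nonneg)
  have diff: "\<xi>' - \<xi> = - (\<mu> *\<^sub>R g)" unfolding \<xi>' by simp
  have "bregman_real \<theta> \<xi>' z x' \<le> bregman_real \<theta> \<xi> z x + blinfun_apply (\<xi>' - \<xi>) (x - z)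
           + 2 / q * norm (\<xi>' - \<xi>) powr q / (2 * c) powr (q - 1) + 2 * e"
    by (rule bregman_step[OF x x' conjugate])
  moreover have "blinfun_apply (\<xi>' - \<xi>) (x - z) \<le> - ((1 - \<gamma>) * (\<mu> * r powr s))"
    using mult_left_mono[OF pairing \<mu>0] unfolding diff
    by (simp add: blinfun.minus_left blinfun.scaleR_left ac_simps)
  moreover have "2 / q * norm (\<xi>' - \<xi>) powr q / (2 * c) powr (q - 1) \<le> C' * (\<mu> * r powr s) + e"
  proof -
    have "norm (\<xi>' - \<xi>) powr q \<le> \<beta>\<^sub>0 powr (q - 1) * (\<mu> * r powr s + e)"
      unfolding diff using step_energy[OF small] \<mu>0 \<mu> by simp
    then have "2 / q * norm (\<xi>' - \<xi>) powr q / (2 * c) powr (q - 1)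
        \<le> 2 / q * (\<beta>\<^sub>0 powr (q - 1) * (\<mu> * r powr s + e)) / (2 * c) powr (q - 1)"
      using q_gt_1 by (intro divide_right_mono mult_left_mono) auto
    also have "\<dots> = C' * (\<mu> * r powr s + e)"
      using \<beta>\<^sub>0_pos c_pos by (simp add: C'_def powr_divide)
    also have "\<dots> \<le> C' * (\<mu> * r powr s) + e"
      using mult_right_mono[of C' 1 e] C e_pos by (simp add: C'_def distrib_left)
    finally show ?thesis .
  qed
  ultimately show ?thesis unfolding C'_def[symmetric] by (simp add: algebra_simps)
qed

text \<open>
  Subtracting the accumulated errors turns \<open>u\<close> into a decreasing sequence that is bounded below.
\<close>

lemma quasi_descent:
  fixes u w \<epsilon> :: "nat \<Rightarrow> real"
  assumes step: "\<And>n. u (Suc n) + w n \<le> u n + 3 * \<epsilon> n" and w: "\<And>n. w n \<ge> 0"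
    and \<epsilon>: "\<And>n. \<epsilon> n \<ge> 0" "summable \<epsilon>" and below: "\<And>n. u n \<ge> - \<epsilon> n"
  shows "convergent u" and "summable w"
proof -
  define v where "v n = u n - 3 * (\<Sum>k<n. \<epsilon> k)" for n
  have v_step: "v (Suc n) + w n \<le> v n" for n
    using step[of n] by (simp add: v_def)
  have partial: "(\<Sum>k<n. \<epsilon> k) \<le> suminf \<epsilon>" for n
    using \<epsilon> by (intro sum_le_suminf) auto
  have v_below: "v n \<ge> - (4 * suminf \<epsilon>)" for n
    using below[of n] partial[of n] partial[of "Suc n"] \<epsilon>(1)[of n] sum_nonneg[of "{..<n}" \<epsilon>] \<epsilon>(1)
    by (simp add: v_def)
  have "decseq v"
  proof (rule decseq_SucI)
    show "v (Suc n) \<le> v n" for n using v_step[of n] w[of n] by linarith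
  qed
  then obtain l where "v \<longlonglongrightarrow> l"
    using decseq_convergent v_below by blast
  moreover have "(\<lambda>n. 3 * (\<Sum>k<n. \<epsilon> k)) \<longlonglongrightarrow> 3 * suminf \<epsilon>"
    by (intro tendsto_mult_left summable_LIMSEQ \<epsilon>)
  ultimately have "(\<lambda>n. v n + 3 * (\<Sum>k<n. \<epsilon> k)) \<longlonglongrightarrow> l + 3 * suminf \<epsilon>"
    by (rule tendsto_add)
  then show "convergent u" unfolding v_def convergent_def by auto
  show "summable w"
  proof (rule summableI_nonneg_bounded[OF w])
    fix n
    have "(\<Sum>k<n. w k) \<le> v 0 - v n"
    proof (induction n)
      case (Suc n)
      then show ?case using v_step[of n] by simp
    qed simp
    then show "(\<Sum>k<n. w k) \<le> v 0 + 4 * suminf \<epsilon>" using v_below[of n] by linarith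
  qed
qed

text \<open>
  Homogeneity: if \<open>d\<close> exceeds \<open>T\<close>, both terms on the right are at most a multiple of \<open>T * d powr (p - 1)\<close>,
  because \<open>p \<ge> 2\<close>.
\<close>

lemma le_mult_of_powr_le:
  fixes d T :: real
  assumes p: "p \<ge> 2" and c: "c > 0" and B: "B \<ge> 0" and T: "T > 0" and d: "d \<ge> 0"
    and le: "c * d powr p \<le> B * T powr (p - 1) * d + T powr p"
  shows "d \<le> max 1 ((B + 1) / c) * T"
proof (cases "d \<le> T")
  case True
  also have "T = 1 * T" by simp
  also have "\<dots> \<le> max 1 ((B + 1) / c) * T" using T by (intro mult_right_mono) auto
  finally show ?thesis .
next
  case False
  then have dT: "d > T" by simp
  have shift: "a powr p = a * a powr (p - 1)" "a powr (p - 1) = a * a powr (p - 2)" if "a > 0" for a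
    using that powr_add[of a 1 "p - 1"] powr_add[of a 1 "p - 2"] by auto
  have "T powr (p - 1) * d \<le> T * d powr (p - 1)"
    using shift(2)[of T] shift(2)[of d] T dT p powr_mono2[of "p - 2" T d]
      mult_left_mono[of "T powr (p - 2)" "d powr (p - 2)" "T * d"] by (simp add: ac_simps)
  then have "B * T powr (p - 1) * d \<le> B * (T * d powr (p - 1))"
    using B mult_left_mono by (metis mult.assoc)
  moreover have "T powr p \<le> T * d powr (p - 1)"
    unfolding shift(1)[OF T] using T dT p by (intro mult_left_mono powr_mono2) auto
  ultimately have sum_le: "B * T powr (p - 1) * d + T powr p \<le> B * (T * d powr (p - 1)) + T * d powr (p - 1)"
    by (rule add_mono)
  have "(c * d) * d powr (p - 1) = c * d powr p" using shift(1)[of d] T dT by simp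
  also note le
  also note sum_le
  also have "B * (T * d powr (p - 1)) + T * d powr (p - 1) = ((B + 1) * T) * d powr (p - 1)"
    by (simp add: algebra_simps)
  finally have "(c * d) * d powr (p - 1) \<le> ((B + 1) * T) * d powr (p - 1)" .
  then have "c * d \<le> (B + 1) * T" using T dT by simp
  then have "d \<le> (B + 1) / c * T" using c by (simp add: field_simps)
  also have "\<dots> \<le> max 1 ((B + 1) / c) * T" using T by (intro mult_right_mono) auto
  finally show ?thesis .
qed

section \<open>From extended-real to real values\<close>

lemma eff_dom_real:
  assumes "proper_fun \<Theta>" "x \<in> eff_dom \<Theta>"
  shows "\<Theta> x = ereal (real_of_ereal (\<Theta> x))"
proof -
  have "\<Theta> x \<noteq> -\<infinity>" "\<Theta> x < \<infinity>"
    using assms unfolding proper_fun_def eff_dom_def by blast+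
  then show ?thesis by (cases "\<Theta> x") auto
qed

lemma in_eff_domI: "\<Theta> x \<le> ereal a \<Longrightarrow> x \<in> eff_dom \<Theta>"
  unfolding eff_dom_def by (cases "\<Theta> x") auto

lemma p_convex_function_eff_dom:
  fixes \<Theta> :: "'a::banach \<Rightarrow> ereal"
  assumes p: "p \<ge> 2" and c: "c > 0" and proper: "proper_fun \<Theta>"
    and lsc: "lower_semicont \<Theta>" and conv: "p_convex p c \<Theta>"
  shows "p_convex_function (eff_dom \<Theta>) (\<lambda>x. real_of_ereal (\<Theta> x)) p c"
proof
  show "p \<ge> 2" "c > 0" by (rule p, rule c)
next
  fix x z :: 'a and t :: real
  assume x: "x \<in> eff_dom \<Theta>" and z: "z \<in> eff_dom \<Theta>" and t: "0 \<le> t" "t \<le> 1"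
  define m where "m = t *\<^sub>R z + (1 - t) *\<^sub>R x"
  define a where "a = t * real_of_ereal (\<Theta> z) + (1 - t) * real_of_ereal (\<Theta> x)"
  define b where "b = c * t * (1 - t) * norm (z - x) powr p"
  have "\<Theta> m + ereal b \<le> ereal t * \<Theta> z + ereal (1 - t) * \<Theta> x"
    using conv t unfolding p_convex_def m_def b_def by blast
  also have "\<dots> = ereal a"
    by (subst eff_dom_real[OF proper x], subst eff_dom_real[OF proper z]) (simp add: a_def)
  finally have le: "\<Theta> m + ereal b \<le> ereal a" .
  have "\<Theta> m \<noteq> -\<infinity>" using proper by (simp add: proper_fun_def)
  with le obtain v where v: "\<Theta> m = ereal v" by (cases "\<Theta> m") auto
  show "t *\<^sub>R z + (1 - t) *\<^sub>R x \<in> eff_dom \<Theta>"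
    using v unfolding m_def[symmetric] by (simp add: eff_dom_def)
  show "real_of_ereal (\<Theta> (t *\<^sub>R z + (1 - t) *\<^sub>R x)) + c * t * (1 - t) * norm (z - x) powr p
          \<le> t * real_of_ereal (\<Theta> z) + (1 - t) * real_of_ereal (\<Theta> x)"
    using le v unfolding m_def[symmetric] a_def[symmetric] b_def[symmetric] by simp
next
  fix u :: "nat \<Rightarrow> 'a" and v C
  assume u: "u \<longlonglongrightarrow> v"
    and ev: "\<forall>\<^sub>F k in sequentially. u k \<in> eff_dom \<Theta> \<and> real_of_ereal (\<Theta> (u k)) \<le> C"
  have "\<Theta> v \<le> ereal C"
  proof (rule ccontr)
    assume "\<not> \<Theta> v \<le> ereal C"
    then have gt: "ereal C < \<Theta> v" by simp
    have "\<Theta> v \<le> Liminf (at v) \<Theta>" using lsc by (simp add: lower_semicont_def)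
    then have "\<forall>\<^sub>F w in at v. ereal C < \<Theta> w"
      using gt by (simp add: le_Liminf_iff)
    then have "\<forall>\<^sub>F w in nhds v. ereal C < \<Theta> w"
      using gt by (simp add: eventually_nhds_conv_at)
    then have "\<forall>\<^sub>F k in sequentially. ereal C < \<Theta> (u k)"
      by (rule eventually_compose_filterlim[OF _ u])
    with ev have "\<forall>\<^sub>F k in sequentially. False"
    proof eventually_elim
      case (elim k)
      then show False using eff_dom_real[OF proper, of "u k"] by (metis ereal_less_eq(3) not_le)
    qed
    then show False by simp
  qed
  then have v: "v \<in> eff_dom \<Theta>" by (rule in_eff_domI)
  with \<open>\<Theta> v \<le> ereal C\<close> show "v \<in> eff_dom \<Theta> \<and> real_of_ereal (\<Theta> v) \<le> C"
    using eff_dom_real[OF proper v] by (metis ereal_less_eq(3))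
qed

section \<open>Convergence of the Landweber-Kaczmarz method\<close>

theorem theorem3p6:
  fixes N :: nat
    and Y :: "nat \<Rightarrow> 'y::banach set"
    and \<Theta> :: "'x::banach \<Rightarrow> ereal"
    and D :: "nat \<Rightarrow> 'x set"
    and F :: "nat \<Rightarrow> 'x \<Rightarrow> 'y"
    and y :: "nat \<Rightarrow> 'y"
    and L :: "nat \<Rightarrow> 'x \<Rightarrow> ('x \<Rightarrow>\<^sub>L 'y)"
    and S :: "real \<Rightarrow> ('x \<Rightarrow>\<^sub>L real) \<Rightarrow> 'x"
    and \<epsilon> :: "nat \<Rightarrow> real"
    and p pstar s c\<^sub>0 \<rho> \<gamma> \<beta> \<beta>\<^sub>0 \<beta>\<^sub>1 \<sigma> \<kappa> :: real
    and x\<^sub>0 :: 'x and \<xi>\<^sub>0 :: "'x \<Rightarrow>\<^sub>L real"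
    and \<xi> :: "nat \<Rightarrow> ('x \<Rightarrow>\<^sub>L real)" and x :: "nat \<Rightarrow> 'x"
  assumes N: "N \<ge> 1"
    and X_reflexive: "reflexive_on (UNIV :: 'x set)"
    and Y_space: "\<And>i. i < N \<Longrightarrow> subspace (Y i) \<and> closed (Y i)"
    and Y_reflexive: "\<And>i. i < N \<Longrightarrow> reflexive_on (Y i)"
    and Y_smooth: "\<And>i. i < N \<Longrightarrow> uniformly_smooth_on (Y i)"
    and F_range: "\<And>i z. i < N \<Longrightarrow> z \<in> D i \<Longrightarrow> F i z \<in> Y i"
    and y_range: "\<And>i. i < N \<Longrightarrow> y i \<in> Y i"
    and p: "p \<ge> 2" and pstar: "1 / p + 1 / pstar = 1"
    and s: "s > 1"
    and A1a: "c\<^sub>0 > 0" "proper_fun \<Theta>" "lower_semicont \<Theta>" "p_convex p c\<^sub>0 \<Theta>"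
    and A1b: "\<rho> > 0" "\<xi>\<^sub>0 \<in> eps_subdiff 0 \<Theta> x\<^sub>0" "cball x\<^sub>0 (2 * \<rho>) \<subseteq> (\<Inter>i<N. D i)"
      "\<exists>xdag \<in> eff_dom \<Theta>. is_solution N D F y xdag \<and>
         bregman_dist 0 \<xi>\<^sub>0 \<Theta> xdag x\<^sub>0 \<le> ereal (1 / 4 * c\<^sub>0 * \<rho> powr p)"
    and A1c: "\<And>i z. i < N \<Longrightarrow> z \<in> cball x\<^sub>0 (2 * \<rho>) \<Longrightarrow> range (blinfun_apply (L i z)) \<subseteq> Y i"
      "\<And>i. i < N \<Longrightarrow> continuous_on (cball x\<^sub>0 (2 * \<rho>)) (L i)"
      "0 \<le> \<gamma>" "\<gamma> < 1"
      "\<And>i z' z. i < N \<Longrightarrow> z' \<in> cball x\<^sub>0 (2 * \<rho>) \<Longrightarrow> z \<in> cball x\<^sub>0 (2 * \<rho>) \<Longrightarrow>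
         norm (F i z' - F i z - blinfun_apply (L i z) (z' - z)) \<le> \<gamma> * norm (F i z' - F i z)"
    and A2: "\<And>e. e > 0 \<Longrightarrow> continuous_on UNIV (S e)"
      "\<And>e \<eta>. e > 0 \<Longrightarrow> \<Theta> (S e \<eta>) - ereal (blinfun_apply \<eta> (S e \<eta>))
         \<le> (INF z. \<Theta> z - ereal (blinfun_apply \<eta> z)) + ereal e"
    and eps: "\<And>n. \<epsilon> n > 0" "summable \<epsilon>" "16 * (\<Sum>n. \<epsilon> n) \<le> c\<^sub>0 * \<rho> powr p"
    and beta: "\<beta> > 1" "\<beta> * \<gamma> < 1"
    and beta1: "\<beta>\<^sub>1 > 0"
    and beta0: "\<beta>\<^sub>0 > 0" "1 / \<beta> - \<gamma> - 2 / pstar * (\<beta>\<^sub>0 / (2 * c\<^sub>0)) powr (pstar - 1) > 0"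
    and kappa: "\<kappa> = (if p \<ge> s then 1 else (\<beta> powr (p / (s - p)) - 1) powr ((p - s) / p))"
    and sigma: "\<sigma> > 0" "\<kappa> * \<beta>\<^sub>1 * \<sigma> \<le> 1"
    and iterates: "landweber_kaczmarz N Y F y L S \<epsilon> p s \<beta>\<^sub>0 \<beta>\<^sub>1 \<sigma> x\<^sub>0 \<xi>\<^sub>0 \<xi> x"
  shows "\<exists>xstar \<in> cball x\<^sub>0 (2 * \<rho>) \<inter> eff_dom \<Theta>.
           is_solution N D F y xstar \<and>
           (\<lambda>n. norm (x n - xstar)) \<longlonglongrightarrow> 0 \<and>
           (\<lambda>n. bregman_dist (\<epsilon> n) (\<xi> n) \<Theta> xstar (x n)) \<longlonglongrightarrow> 0"
proof -
  define A where "A = eff_dom \<Theta>"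
  define \<theta> where "\<theta> z = real_of_ereal (\<Theta> z)" for z
  interpret p_convex_function A \<theta> p c\<^sub>0
    unfolding A_def \<theta>_def[abs_def] using p A1a by (intro p_convex_function_eff_dom)
  have \<Theta>_real: "\<Theta> z = ereal (\<theta> z)" if "z \<in> A" for z
    using eff_dom_real[OF A1a(2)] that by (simp add: A_def \<theta>_def)
  define U where "U = cball x\<^sub>0 (2 * \<rho>)"
  obtain xdag where xdag: "xdag \<in> A" "is_solution N D F y xdag"
      "bregman_dist 0 \<xi>\<^sub>0 \<Theta> xdag x\<^sub>0 \<le> ereal (1 / 4 * c\<^sub>0 * \<rho> powr p)"
    using A1b(4) unfolding A_def by blast

  have sub0: "subgradient 0 \<xi>\<^sub>0 x\<^sub>0"
  proof -
    have le: "\<Theta> x\<^sub>0 + ereal (\<xi>\<^sub>0 (z - x\<^sub>0)) \<le> \<Theta> z" for z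
      using A1b(2) by (simp add: eps_subdiff_def zero_ereal_def[symmetric])
    have "\<Theta> x\<^sub>0 \<noteq> \<infinity>" using le[of xdag] \<Theta>_real[OF xdag(1)] by auto
    then have x0: "x\<^sub>0 \<in> A" by (simp add: A_def eff_dom_def less_top[symmetric] top_ereal_def)
    have "bregman_real \<theta> \<xi>\<^sub>0 z x\<^sub>0 \<ge> - 0" if "z \<in> A" for z
      using le[of z] \<Theta>_real[OF that] \<Theta>_real[OF x0] by (simp add: bregman_real_def)
    with x0 show ?thesis by (simp add: subgradient_def)
  qed
  have approx_min: "subgradient e \<eta> (S e \<eta>)" if e: "e > 0" for e \<eta>
  proof -
    have le: "\<Theta> (S e \<eta>) - ereal (\<eta> (S e \<eta>)) \<le> ereal (\<theta> z - \<eta> z + e)" if "z \<in> A" for z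
    proof -
      have "(INF z. \<Theta> z - ereal (\<eta> z)) \<le> \<Theta> z - ereal (\<eta> z)" by (rule INF_lower) simp
      then have "(INF z. \<Theta> z - ereal (\<eta> z)) + ereal e \<le> \<Theta> z - ereal (\<eta> z) + ereal e"
        by (rule add_right_mono)
      with A2(2)[OF e, of \<eta>] have "\<Theta> (S e \<eta>) - ereal (\<eta> (S e \<eta>)) \<le> \<Theta> z - ereal (\<eta> z) + ereal e"
        by (rule order_trans)
      then show ?thesis using \<Theta>_real[OF that] by simp
    qed
    have S: "S e \<eta> \<in> A"
      using le[OF xdag(1)] unfolding A_def by (cases "\<Theta> (S e \<eta>)") (auto simp: eff_dom_def)
    have "bregman_real \<theta> \<eta> z (S e \<eta>) \<ge> - e" if "z \<in> A" for z
      using le[OF that] \<Theta>_real[OF S] by (simp add: bregman_real_def blinfun.diff_right)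
    with S show ?thesis by (simp add: subgradient_def)
  qed

  obtain j where
    start: "\<xi> 0 = \<xi>\<^sub>0" "x 0 = x\<^sub>0" and
    j: "\<And>n. j n \<in> duality_map_on (Y (n mod N)) s (F (n mod N) (x n) - y (n mod N))" and
    \<xi>_Suc: "\<And>n. \<xi> (Suc n) = \<xi> n - step_size p s \<beta>\<^sub>0 \<beta>\<^sub>1 \<sigma> (\<epsilon> n) (norm (F (n mod N) (x n) - y (n mod N)))
       (norm (adjoint_apply (L (n mod N) (x n)) (j n))) *\<^sub>R adjoint_apply (L (n mod N) (x n)) (j n)" and
    x_Suc: "\<And>n. x (Suc n) = S (\<epsilon> (Suc n)) (\<xi> (Suc n))"
    using iterates unfolding landweber_kaczmarz_def Let_def by blast
  define r where "r n = F (n mod N) (x n) - y (n mod N)" for n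
  define g where "g n = adjoint_apply (L (n mod N) (x n)) (j n)" for n
  define \<mu> where "\<mu> n = step_size p s \<beta>\<^sub>0 \<beta>\<^sub>1 \<sigma> (\<epsilon> n) (norm (r n)) (norm (g n))" for n
  have \<xi>_step: "\<xi> (Suc n) = \<xi> n - \<mu> n *\<^sub>R g n" for n
    unfolding \<xi>_Suc \<mu>_def r_def g_def ..
  have modN: "n mod N < N" for n using N by simp

  \<comment> \<open>The initial pair is exact, which is more than tolerance \<open>\<epsilon> 0\<close> asks for.\<close>
  have sub: "subgradient (\<epsilon> n) (\<xi> n) (x n)" for n
  proof (cases n)
    case 0
    have "- \<epsilon> 0 \<le> - 0" using eps(1)[of 0] by simp
    then show ?thesis using sub0 unfolding 0 start subgradient_def by (meson order_trans)
  next
    case (Suc m)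
    show ?thesis unfolding Suc x_Suc by (rule approx_min[OF eps(1)])
  qed
  have xA: "x n \<in> A" for n using sub by (simp add: subgradient_def)

  interpret rule: step_rule p pstar s \<beta>\<^sub>0 \<beta>\<^sub>1 \<sigma> "\<epsilon> n" "norm (r n)" "norm (g n)" for n
    using p pstar s beta0 beta1 sigma eps(1) by unfold_locales auto
  have \<mu>_nonneg: "\<mu> n \<ge> 0" for n unfolding \<mu>_def by (rule rule.\<mu>_nonneg)
  define C where "C = 2 / pstar * (\<beta>\<^sub>0 / (2 * c\<^sub>0)) powr (pstar - 1)"
  have "1 / \<beta> < 1" using beta by simp
  then have C: "C \<le> 1" "1 - \<gamma> - C > 0" using beta0(2) A1c(3) unfolding C_def by linarith+
  \<comment> \<open>If \<open>s \<le> p\<close>, then \<open>\<kappa> = 1\<close>.\<close>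
  have small: "s \<le> p \<Longrightarrow> \<beta>\<^sub>1 * \<sigma> \<le> 1" using sigma(2) kappa by simp

  define Z where "Z = {z \<in> U \<inter> A. is_solution N D F y z}"
  have L_range: "range (blinfun_apply (L (n mod N) (x n))) \<subseteq> Y (n mod N)" if "x n \<in> U" for n
    using A1c(1)[OF modN] that by (simp add: U_def)
  have subsp: "subspace (Y (n mod N))" for n using Y_space[OF modN] by blast
  have j': "j n \<in> duality_map_on (Y (n mod N)) s (r n)" for n unfolding r_def by (rule j)
  have r_in: "r n \<in> Y (n mod N)" if "x n \<in> U" for n
    unfolding r_def using that A1b(3) modN[of n] subsp F_range y_range
    by (intro subspace_diff) (auto simp: U_def)
  have tcc: "norm (F i z' - F i z - L i z (z' - z)) \<le> \<gamma> * norm (F i z' - F i z)"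
    if "i < N" "z' \<in> U" "z \<in> U" for i z' z
    using A1c(5) that by (simp add: U_def)

  have descent: "bregman_real \<theta> (\<xi> (Suc n)) z (x (Suc n)) + (1 - \<gamma> - C) * (\<mu> n * norm (r n) powr s)
      \<le> bregman_real \<theta> (\<xi> n) z (x n) + 3 * \<epsilon> n" if z: "z \<in> Z" and xU: "x n \<in> U" for n z
  proof -
    have "F (n mod N) z = y (n mod N)" and zU: "z \<in> U"
      using z modN by (auto simp: Z_def is_solution_def)
    then have "norm (r n - L (n mod N) (x n) (x n - z)) \<le> \<gamma> * norm (r n)"
      using tcc[OF modN zU xU, of n] unfolding r_def
      by (simp add: norm_minus_commute blinfun.diff_right algebra_simps)
    then have "(1 - \<gamma>) * norm (r n) powr s \<le> g n (x n - z)"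
      unfolding g_def using adjoint_duality_ge[OF subsp j' L_range[OF xU] r_in[OF xU]] by blast
    from landweber_step_descent[OF rule.step_rule_axioms small C(1)[unfolded C_def] sub xA \<mu>_def \<xi>_step this,
        of "Suc n"]
    show ?thesis unfolding C_def[symmetric] by linarith
  qed

  have E: "16 * (\<Sum>k<n. \<epsilon> k) \<le> c\<^sub>0 * \<rho> powr p" for n
  proof -
    have "(\<Sum>k<n. \<epsilon> k) \<le> suminf \<epsilon>" using eps(1,2) by (intro sum_le_suminf) (auto simp: less_imp_le)
    with eps(3) show ?thesis by linarith
  qed
  have within_\<rho>: "norm (xdag - w) \<le> \<rho>" if "c\<^sub>0 / 2 * norm (xdag - w) powr p \<le> c\<^sub>0 * \<rho> powr p / 2" for w
  proof (rule ccontr)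
    assume "\<not> norm (xdag - w) \<le> \<rho>"
    then have "\<rho> powr p < norm (xdag - w) powr p"
      using A1b(1) p by (intro powr_less_mono2) auto
    with that A1a(1) show False by simp
  qed
  have b0: "bregman_real \<theta> (\<xi> 0) xdag (x 0) \<le> c\<^sub>0 * \<rho> powr p / 4"
    using xdag(3) \<Theta>_real[OF xdag(1)] \<Theta>_real[OF xA[of 0]] unfolding start
    by (simp add: bregman_dist_def bregman_real_def)
  have radius_pos: "c\<^sub>0 * \<rho> powr p > 0" using A1a(1) A1b(1) by simp
  have "norm (xdag - x\<^sub>0) \<le> \<rho>"
    by (rule within_\<rho>, rule order_trans[OF bregman_growth[OF sub0 xdag(1)]])
       (use b0 radius_pos in \<open>simp add: start\<close>)
  then have xdagU: "xdag \<in> U"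
    using A1b(1) by (simp add: U_def dist_norm norm_minus_commute)
  have xdagZ: "xdag \<in> Z" using xdag xdagU by (simp add: Z_def)
  \<comment> \<open>In units of \<open>c\<^sub>0 * \<rho> powr p\<close> the initial distance contributes \<open>1/4\<close>, the errors at most \<open>3/16\<close>, and \<open>1/4 + 3/16 < 1/2\<close>.\<close>
  have xU_of_b: "x n \<in> U"
    if "bregman_real \<theta> (\<xi> n) xdag (x n) \<le> c\<^sub>0 * \<rho> powr p / 4 + 3 * (\<Sum>k<n. \<epsilon> k)" for n
  proof -
    have "c\<^sub>0 / 2 * norm (xdag - x n) powr p \<le> bregman_real \<theta> (\<xi> n) xdag (x n) + 2 * \<epsilon> n"
      by (rule bregman_growth[OF sub xdag(1)])
    also have "\<dots> \<le> c\<^sub>0 * \<rho> powr p / 4 + 3 * (\<Sum>k<Suc n. \<epsilon> k)"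
      using that eps(1)[of n] by simp
    also have "\<dots> \<le> c\<^sub>0 * \<rho> powr p / 2"
      using E[of "Suc n"] radius_pos by linarith
    finally have "norm (xdag - x n) \<le> \<rho>" by (rule within_\<rho>)
    with \<open>norm (xdag - x\<^sub>0) \<le> \<rho>\<close> have "norm (x\<^sub>0 - x n) \<le> 2 * \<rho>"
      using norm_triangle_ineq4[of "xdag - x n" "xdag - x\<^sub>0"] by simp
    then show ?thesis by (simp add: U_def dist_norm)
  qed
  have "x n \<in> U \<and> bregman_real \<theta> (\<xi> n) xdag (x n) \<le> c\<^sub>0 * \<rho> powr p / 4 + 3 * (\<Sum>k<n. \<epsilon> k)" for n
  proof (induction n)
    case 0
    then show ?case using b0 xU_of_b[of 0] by simp
  next
    case (Suc n)
    have "0 \<le> (1 - \<gamma> - C) * (\<mu> n * norm (r n) powr s)" using C \<mu>_nonneg by simp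
    with Suc descent[OF xdagZ, of n]
    have "bregman_real \<theta> (\<xi> (Suc n)) xdag (x (Suc n)) \<le> c\<^sub>0 * \<rho> powr p / 4 + 3 * (\<Sum>k<Suc n. \<epsilon> k)"
      by simp
    with xU_of_b show ?case by blast
  qed
  then have xU: "x n \<in> U" for n by blast

  have quasi: "convergent (\<lambda>n. bregman_real \<theta> (\<xi> n) z (x n))"
      "summable (\<lambda>n. (1 - \<gamma> - C) * (\<mu> n * norm (r n) powr s))" if z: "z \<in> Z" for z
  proof -
    have step: "bregman_real \<theta> (\<xi> (Suc n)) z (x (Suc n)) + (1 - \<gamma> - C) * (\<mu> n * norm (r n) powr s)
      \<le> bregman_real \<theta> (\<xi> n) z (x n) + 3 * \<epsilon> n" for n
      by (rule descent[OF z xU])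
    have w: "0 \<le> (1 - \<gamma> - C) * (\<mu> n * norm (r n) powr s)" for n
      using C \<mu>_nonneg by simp
    have below: "bregman_real \<theta> (\<xi> n) z (x n) \<ge> - \<epsilon> n" for n
      using sub[of n] z by (simp add: subgradient_def Z_def)
    have e: "\<epsilon> n \<ge> 0" for n using eps(1)[of n] by simp
    show "convergent (\<lambda>n. bregman_real \<theta> (\<xi> n) z (x n))"
      by (rule quasi_descent(1)[OF step w e eps(2) below])
    show "summable (\<lambda>n. (1 - \<gamma> - C) * (\<mu> n * norm (r n) powr s))"
      by (rule quasi_descent(2)[OF step w e eps(2) below])
  qed

  have "\<exists>K\<ge>0. (\<forall>z\<in>U. norm (L i z) \<le> K) \<and>
           (\<forall>z'\<in>U. \<forall>z\<in>U. norm (F i z' - F i z) \<le> K * norm (z' - z))" if i: "i < N" for i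
    unfolding U_def using A1b(1) A1c(3,4) A1c(5)[OF i] by (intro tangential_cone_bounds) auto
  then obtain Ki where Ki: "\<And>i. i < N \<Longrightarrow> Ki i \<ge> 0"
      "\<And>i z. i < N \<Longrightarrow> z \<in> U \<Longrightarrow> norm (L i z) \<le> Ki i"
      "\<And>i z' z. i < N \<Longrightarrow> z' \<in> U \<Longrightarrow> z \<in> U \<Longrightarrow> norm (F i z' - F i z) \<le> Ki i * norm (z' - z)"
    by metis
  \<comment> \<open>One constant for all equations; the summand 1 makes it positive.\<close>
  define B where "B = 1 + (\<Sum>i<N. Ki i)"
  have Ki_le: "Ki i \<le> B" if "i < N" for i
    using member_le_sum[of i "{..<N}" Ki] Ki(1) that by (simp add: B_def)
  have B: "B > 0" using sum_nonneg[of "{..<N}" Ki] Ki(1) by (simp add: B_def)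
  have L_le: "norm (L i z) \<le> B" if "i < N" "z \<in> U" for i z
    using Ki(2)[OF that] Ki_le[OF that(1)] by simp
  have F_lip: "norm (F i z' - F i z) \<le> B * norm (z' - z)" if "i < N" "z' \<in> U" "z \<in> U" for i z' z
    using Ki(3)[OF that] Ki_le[OF that(1)] mult_right_mono[of "Ki i" B "norm (z' - z)"] by simp

  have g_le: "norm (g n) \<le> B * norm (r n) powr (s - 1)" for n
  proof -
    have "norm (g n) \<le> norm (L (n mod N) (x n)) * norm (r n) powr (s - 1)"
      unfolding g_def by (rule norm_adjoint_duality_le[OF subsp j' L_range[OF xU]])
    also have "\<dots> \<le> B * norm (r n) powr (s - 1)"
      by (intro mult_right_mono L_le modN xU) simp
    finally show ?thesis .
  qed

  \<comment> \<open>The tolerances at \<open>n\<close> and \<open>Suc n\<close> both enter the length of the step from \<open>x n\<close> to \<open>x (Suc n)\<close>.\<close>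
  define T where "T n = (norm (r n) powr p + \<sigma> * \<epsilon> n + 2 * \<epsilon> n + 2 * \<epsilon> (Suc n)) powr (1 / p)" for n
  have base: "norm (r n) powr p + \<sigma> * \<epsilon> n > 0" for n by (rule rule.P_pos)
  have T_pos: "T n > 0" for n
    using base[of n] eps(1)[of n] eps(1)[of "Suc n"] by (simp add: T_def)
  have T_powr: "T n powr p = norm (r n) powr p + \<sigma> * \<epsilon> n + 2 * \<epsilon> n + 2 * \<epsilon> (Suc n)" for n
    using base[of n] eps(1)[of n] eps(1)[of "Suc n"] p by (simp add: T_def powr_powr)
  have r_le_T: "norm (r n) \<le> T n" for n
  proof -
    have "norm (r n) = (norm (r n) powr p) powr (1 / p)" using p by (simp add: powr_powr)
    also have "\<dots> \<le> T n" unfolding T_def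
      using p sigma(1) eps(1)[of n] eps(1)[of "Suc n"] by (intro powr_mono2) auto
    finally show ?thesis .
  qed
  have \<mu>r_le_T: "\<mu> n * norm (r n) powr (s - 1) \<le> \<beta>\<^sub>1 * T n powr (p - 1)" for n
  proof -
    have "\<mu> n * norm (r n) powr (s - 1) \<le> \<beta>\<^sub>1 * (norm (r n) powr p + \<sigma> * \<epsilon> n) powr ((p - 1) / p)"
      unfolding \<mu>_def by (rule rule.step_size_bound)
    also have "\<dots> \<le> \<beta>\<^sub>1 * (T n powr p) powr ((p - 1) / p)"
      using base[of n] beta1 p eps(1)[of n] eps(1)[of "Suc n"]
      by (intro mult_left_mono powr_mono2) (auto simp: T_powr)
    also have "(T n powr p) powr ((p - 1) / p) = T n powr (p - 1)" using p by (simp add: powr_powr)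
    finally show ?thesis .
  qed
  have T_summable: "summable (\<lambda>n. T n powr p)"
  proof -
    have w: "summable (\<lambda>n. \<mu> n * norm (r n) powr s)"
      using quasi(2)[OF xdagZ] C(2) summable_cmult_iff[of "1 - \<gamma> - C"] by auto
    define m where "m = 2 powr (s / p) / min (\<beta>\<^sub>0 / B powr p) \<beta>\<^sub>1"
    have "summable (\<lambda>n. m * (\<mu> n * norm (r n) powr s) + \<sigma> * \<epsilon> n)"
      by (intro summable_add summable_mult w eps(2))
    then have "summable (\<lambda>n. norm (r n) powr p)"
    proof (rule summable_comparison_test'[where N = 0])
      show "norm (norm (r n) powr p) \<le> m * (\<mu> n * norm (r n) powr s) + \<sigma> * \<epsilon> n" for n
        using rule.residual_bound[OF B g_le, of n] by (simp add: m_def \<mu>_def)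
    qed
    moreover have "summable (\<lambda>n. \<epsilon> (Suc n))" using eps(2) by (simp add: summable_Suc_iff)
    ultimately show ?thesis
      unfolding T_powr by (intro summable_add summable_mult eps(2))
  qed

  \<comment> \<open>The constant of \<open>le_mult_of_powr_le\<close> for the estimate of the step length.\<close>
  define Kd where "Kd = max 1 ((B * \<beta>\<^sub>1 + 1) / c\<^sub>0)"
  define K where "K = B + Kd + 4 * \<beta>\<^sub>1"
  have K: "B \<le> K" "Kd \<le> K" "4 * \<beta>\<^sub>1 \<le> K" "K \<ge> 0"
    using B beta1 by (auto simp: K_def Kd_def)
  have increment: "norm (x (Suc n) - x n) \<le> K * T n" for n
  proof -
    have h: "norm (\<xi> (Suc n) - \<xi> n) \<le> B * \<beta>\<^sub>1 * T n powr (p - 1)"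
    proof -
      have "norm (\<xi> (Suc n) - \<xi> n) = \<mu> n * norm (g n)" using \<mu>_nonneg by (simp add: \<xi>_step)
      also have "\<dots> \<le> \<mu> n * (B * norm (r n) powr (s - 1))"
        by (intro mult_left_mono g_le \<mu>_nonneg)
      also have "\<dots> = B * (\<mu> n * norm (r n) powr (s - 1))" by simp
      also have "\<dots> \<le> B * (\<beta>\<^sub>1 * T n powr (p - 1))"
        using B by (intro mult_left_mono \<mu>r_le_T) auto
      finally show ?thesis by simp
    qed
    have "c\<^sub>0 * norm (x (Suc n) - x n) powr p
        \<le> norm (\<xi> (Suc n) - \<xi> n) * norm (x (Suc n) - x n) + 2 * \<epsilon> n + 2 * \<epsilon> (Suc n)"
      by (rule distance_between_subgradients[OF sub sub])
    also have "\<dots> \<le> B * \<beta>\<^sub>1 * T n powr (p - 1) * norm (x (Suc n) - x n) + T n powr p"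
      using mult_right_mono[OF h, of "norm (x (Suc n) - x n)"] base[of n] unfolding T_powr by simp
    finally have "norm (x (Suc n) - x n) \<le> Kd * T n"
      unfolding Kd_def using p A1a(1) B beta1 T_pos by (intro le_mult_of_powr_le) auto
    also have "\<dots> \<le> K * T n" using K(2) T_pos[of n] by simp
    finally show ?thesis .
  qed
  define res where "res i u = norm (F i u - y i)" for i u
  have res_lipschitz: "res i (x m) \<le> res i (x n) + K * norm (x m - x n)" if "i < N" for i m n
  proof -
    have "res i (x m) \<le> res i (x n) + norm (F i (x m) - F i (x n))"
      unfolding res_def using norm_triangle_ineq[of "F i (x n) - y i" "F i (x m) - F i (x n)"] by simp
    also have "\<dots> \<le> res i (x n) + B * norm (x m - x n)"
      by (intro add_left_mono F_lip that xU)
    also have "\<dots> \<le> res i (x n) + K * norm (x m - x n)"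
      using K(1) by (intro add_left_mono mult_right_mono) auto
    finally show ?thesis .
  qed
  have dual_increment: "\<bar>blinfun_apply (\<xi> (Suc n) - \<xi> n) (x k - xdag)\<bar>
      \<le> K * T n powr (p - 1) * (T n + res (n mod N) (x k))" for n k
  proof -
    define i where "i = n mod N"
    have i: "i < N" unfolding i_def by (rule modN)
    \<comment> \<open>The cone condition is available only for differences from the point of linearisation \<open>x n\<close>, hence the detour through it.\<close>
    have linearised: "norm (L i (x n) (z - x n)) \<le> 2 * norm (F i z - F i (x n))" if "z \<in> U" for z
      by (rule norm_le_of_relative_error[OF tcc[OF i that xU] less_imp_le[OF A1c(4)]])
    have sol: "F i xdag = y i" using xdag(2) i by (simp add: is_solution_def)
    have "norm (L i (x n) (x k - xdag)) \<le> norm (L i (x n) (x k - x n)) + norm (L i (x n) (xdag - x n))"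
      using norm_triangle_ineq4[of "L i (x n) (x k - x n)" "L i (x n) (xdag - x n)"]
      by (simp add: blinfun.diff_right)
    also have "\<dots> \<le> 2 * norm (F i (x k) - F i (x n)) + 2 * norm (F i xdag - F i (x n))"
      by (intro add_mono linearised xU xdagU)
    also have "\<dots> \<le> 2 * (res i (x k) + norm (r n)) + 2 * norm (r n)"
      using norm_triangle_ineq4[of "F i (x k) - y i" "F i (x n) - y i"]
      unfolding sol r_def i_def[symmetric] res_def by (simp add: norm_minus_commute)
    also have "\<dots> \<le> 4 * (T n + res i (x k))"
    proof -
      have "0 \<le> res i (x k)" by (simp add: res_def)
      with r_le_T[of n] show ?thesis by (simp add: algebra_simps)
    qed
    finally have lin: "norm (L i (x n) (x k - xdag)) \<le> 4 * (T n + res i (x k))" .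
    have "\<bar>blinfun_apply (\<xi> (Suc n) - \<xi> n) (x k - xdag)\<bar> = \<mu> n * \<bar>g n (x k - xdag)\<bar>"
      using \<mu>_nonneg by (simp add: \<xi>_step blinfun.minus_left blinfun.scaleR_left abs_mult)
    also have "\<dots> \<le> \<mu> n * (norm (r n) powr (s - 1) * norm (L i (x n) (x k - xdag)))"
      unfolding g_def i_def by (intro mult_left_mono abs_adjoint_duality_le[OF subsp j' L_range[OF xU]] \<mu>_nonneg)
    also have "\<dots> = \<mu> n * norm (r n) powr (s - 1) * norm (L i (x n) (x k - xdag))" by simp
    also have "\<dots> \<le> \<beta>\<^sub>1 * T n powr (p - 1) * (4 * (T n + res i (x k)))"
      using \<mu>_nonneg beta1 by (intro mult_mono \<mu>r_le_T lin) auto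
    also have "\<dots> = 4 * \<beta>\<^sub>1 * (T n powr (p - 1) * (T n + res i (x k)))" by simp
    also have "\<dots> \<le> K * (T n powr (p - 1) * (T n + res i (x k)))"
      using K(3) T_pos[of n] by (intro mult_right_mono) (auto simp: res_def)
    finally show ?thesis by (simp add: i_def mult.assoc)
  qed
  interpret cycle: kaczmarz_sequence N p K T x \<xi> res xdag
  proof
    show "res (n mod N) (x n) \<le> T n" for n
      using r_le_T[of n] by (simp add: res_def r_def)
  qed (use N p K(4) T_pos T_summable res_lipschitz increment dual_increment in \<open>auto simp: res_def\<close>)
  obtain n :: "nat \<Rightarrow> nat" where n: "strict_mono n"
    and small_pairing: "\<And>\<delta>. \<delta> > 0 \<Longrightarrow> \<exists>M. \<forall>l\<ge>M. \<forall>k\<ge>l.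
         \<bar>blinfun_apply (\<xi> (n k) - \<xi> (n l)) (x (n k) - xdag)\<bar> \<le> \<delta>"
    using cycle.dual_cauchy_along_record_minima by blast

  have limit_in: "u \<in> Z" if lim: "(\<lambda>k. x (n k)) \<longlonglongrightarrow> u" and u: "u \<in> A" for u
  proof -
    have uU: "u \<in> U"
      using closed_sequentially[OF closed_cball _ lim] xU unfolding U_def by blast
    have "F i u = y i" if i: "i < N" for i
    proof -
      have "(\<lambda>k. norm (x (n k) - u)) \<longlonglongrightarrow> 0"
        using lim by (simp add: tendsto_norm_zero LIM_zero)
      then have "(\<lambda>k. B * norm (x (n k) - u) + res i (x (n k))) \<longlonglongrightarrow> B * 0 + 0"
        using LIMSEQ_subseq_LIMSEQ[OF cycle.res_tendsto_0[OF i] n]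
        by (intro tendsto_intros) (auto simp: comp_def)
      moreover have "norm (F i u - y i) \<le> B * norm (x (n k) - u) + res i (x (n k))" for k
      proof -
        have "norm (F i u - y i) \<le> norm (F i (x (n k)) - F i u) + res i (x (n k))"
          unfolding res_def using norm_triangle_ineq4[of "F i (x (n k)) - y i" "F i (x (n k)) - F i u"] by simp
        with F_lip[OF i xU uU, of "n k"] show ?thesis by simp
      qed
      ultimately have "norm (F i u - y i) \<le> B * 0 + 0"
        by (intro LIMSEQ_le_const) auto
      then show ?thesis by simp
    qed
    moreover have "u \<in> D i" if "i < N" for i using uU A1b(3) that by (auto simp: U_def)
    ultimately show ?thesis using uU u by (simp add: Z_def is_solution_def)
  qed
  have "\<exists>xstar\<in>Z. x \<longlonglongrightarrow> xstar \<and> (\<lambda>n. bregman_real \<theta> (\<xi> n) xstar (x n)) \<longlonglongrightarrow> 0"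
  proof (rule convergence_from_subsequence[OF sub summable_LIMSEQ_zero[OF eps(2)] _ xdagZ _ n])
    show "Z \<subseteq> A" by (auto simp: Z_def)
  qed (use quasi(1) small_pairing limit_in in auto)
  then obtain xstar where xstar: "xstar \<in> Z" and lim: "x \<longlonglongrightarrow> xstar"
    and breg: "(\<lambda>n. bregman_real \<theta> (\<xi> n) xstar (x n)) \<longlonglongrightarrow> 0" by blast
  have "xstar \<in> A" using xstar by (simp add: Z_def)
  then have "bregman_dist (\<epsilon> n) (\<xi> n) \<Theta> xstar (x n) = ereal (bregman_real \<theta> (\<xi> n) xstar (x n) + \<epsilon> n)" for n
    using \<Theta>_real xA by (simp add: bregman_dist_def bregman_real_def)
  moreover have "(\<lambda>n. bregman_real \<theta> (\<xi> n) xstar (x n) + \<epsilon> n) \<longlonglongrightarrow> 0 + 0"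
    by (intro tendsto_add breg summable_LIMSEQ_zero eps(2))
  ultimately have "(\<lambda>n. bregman_dist (\<epsilon> n) (\<xi> n) \<Theta> xstar (x n)) \<longlonglongrightarrow> 0"
    by (simp add: zero_ereal_def)
  moreover have "(\<lambda>n. norm (x n - xstar)) \<longlonglongrightarrow> 0"
    using lim by (simp add: tendsto_norm_zero LIM_zero)
  ultimately show ?thesis
    using xstar unfolding Z_def U_def A_def by blast
qed

end
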